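(* (1) The exponential function $\exp_{(0)}$ of the Drinfeld $\mathcal A$-module $\Psi$ is an $\mathbb F_q$-linear entire power series given by $$\exp_{(0)}(\xi)=\sum_{i=0}^\infty \frac{\xi^{q^i}}{D_i},$$ where $D_0=1$ and, for $i\ge 1$, $$D_i=D_{i-1}^{\,q}\,\frac{\theta-\theta^{q^i}}{(\theta^{q^i}-\eta)(\theta-\eta)} .$$ (2) The logarithm function $\log_{(0)}$ of $\Psi$ admits the power series representation $$\log_{(0)}(\xi)=\sum_{j=0}^\infty\frac{(-1)^j\xi^{q^j}}{L_j},$$ where $L_0=1$ and, for $j\ge 1$, $$L_j=L_{j-1}\,\frac{\theta-\theta^{q^j}}{(\theta-\eta^{q^{j-2}})\,(\theta-\eta)^{q^{j-1}}\,(\theta-\eta^{q^{-1}})^{q^j-q^{j-1}}} .$$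
   Context: Let $\mathcal K=\mathbb F_q(t)$ and let $K=\mathbb F_q(\theta)$ be its copy via $\iota:t\mapsto\theta$. Let $\rho\in\mathbb F_q[t]$ be monic irreducible of degree $N\ge 2$, $\eta$ a root of $\rho$, and $\eta^{(i)}=\eta^{q^i}$ for $i\in\mathbb Z$ (this depends only on $i$ mod $N$; in particular $\eta^{q^{-1}}=\eta^{q^{N-1}}$). Let $\mathcal A=H^0(\mathbb P^1-P_\rho,\mathcal O_{\mathbb P^1})$ be the ring of elements of $\mathcal K$ regular away from the place $P_\rho$ of $\rho$; it is generated over $\mathbb F_q$ by $T_i=t^i/\rho(t)$, $0\le i\le N-1$. Let $K_\rho$ be the completion of $K$ at the place of $\rho(\theta)$, containing $\mathbb F_q(\eta)$ with $\theta-\eta$ a uniformizer, and $\mathbb C_\infty$ the completion of an algebraic closure of $K_\rho$, with absolute value $|\cdot|_\eta$ normalized by $|\theta-\eta|_\eta=q^{-1}$. For $g\in\mathbb C_\infty(t)$, $g^{(k)}$ is obtained by raising the coefficients in $\mathbb C_\infty$ to the $q^k$-th power ($t$ fixed). Put $f(t)=\frac1{t-\eta}-\frac1{\theta-\eta}$, $\mathbf s_0=1$, $\mathbf s_i=f^{(0)}f^{(1)}\cdots f^{(i-1)}$. The $\mathbf s_i$ ($i\ge0$) form a $\mathbb C_\infty$-basis of $\mathcal A\otimes_{\mathbb F_q}\mathbb C_\infty=\mathbb C_\infty[\frac1{t-\eta^{(i)}}:0\le i\le N-1]$. The Drinfeld module $\Psi:\mathcal A\to\mathbb C_\infty\{\tau\}$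 (twisted polynomials, $\tau c=c^q\tau$) is defined by $\Psi_a=\sum_i c_i\tau^i$ where $a=\sum_i c_i\mathbf s_i$, $c_i\in\mathbb C_\infty$. It is a Drinfeld module of rank one. $\exp_{(0)}$ is the $\mathbb F_q$-linear function $\mathbb C_\infty\to\mathbb C_\infty$ with derivative $1$ at $0$ and $\Psi_a(\exp_{(0)}(\xi))=\exp_{(0)}(a(\theta)\xi)$ for all $a\in\mathcal A$; $\log_{(0)}$ is its local (formal power series) inverse. *)

theory Defs
  imports "HOL-Analysis.Analysis" "HOL-Computational_Algebra.Computational_Algebra"
begin

text \<open>
  The finite field with \<open>q\<close> elements is a type \<open>'f\<close> of sort \<open>{field, finite}\<close>, so \<open>q = CARD('f)\<close>.
  The field \<open>\<C>\<^sub>\<infinity>\<close> is a type \<open>'c\<close>, and \<open>emb\<close> is the embedding of \<open>'f\<close> into \<open>'c\<close>.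
  Rational functions in \<open>t\<close> are elements of \<open>'f poly fract\<close> and \<open>'c poly fract\<close>.
\<close>

section \<open>Rational functions\<close>

text \<open>
  Extension to the fraction field of an injective ring homomorphism \<open>\<phi>\<close> into a field,
  see \<open>fract_lift_Fract\<close>.
\<close>

definition fract_lift :: "('a::idom \<Rightarrow> 'b::field) \<Rightarrow> 'a fract \<Rightarrow> 'b" where
  "fract_lift \<phi> x = (THE y. \<exists>g h. h \<noteq> 0 \<and> x = Fract g h \<and> y = \<phi> g / \<phi> h)"

lemma fract_lift_Fract:
  fixes \<phi> :: "'a::idom \<Rightarrow> 'b::field"
  assumes mult: "\<And>x y. \<phi> (x * y) = \<phi> x * \<phi> y"
    and nonzero: "\<And>x. x \<noteq> 0 \<Longrightarrow> \<phi> x \<noteq> 0"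
    and h: "h \<noteq> 0"
  shows "fract_lift \<phi> (Fract g h) = \<phi> g / \<phi> h"
  unfolding fract_lift_def
proof (rule the_equality)
  show "\<exists>g' h'. h' \<noteq> 0 \<and> Fract g h = Fract g' h' \<and> \<phi> g / \<phi> h = \<phi> g' / \<phi> h'"
    using h by blast
next
  fix y assume "\<exists>g' h'. h' \<noteq> 0 \<and> Fract g h = Fract g' h' \<and> y = \<phi> g' / \<phi> h'"
  then obtain g' h' where *: "h' \<noteq> 0" "Fract g h = Fract g' h'" "y = \<phi> g' / \<phi> h'" by blast
  from * h have "g * h' = g' * h" by (simp add: eq_fract)
  then have "\<phi> g * \<phi> h' = \<phi> g' * \<phi> h" by (metis mult)
  with * h show "y = \<phi> g / \<phi> h" by (simp add: nonzero frac_eq_eq)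
qed

text \<open>The map \<open>a \<mapsto> a(\<theta>)\<close>; it is meaningful for \<open>\<theta>\<close> transcendental over \<open>'f\<close>.\<close>

definition at_theta :: "('f::field \<Rightarrow> 'c::field) \<Rightarrow> 'c \<Rightarrow> 'f poly fract \<Rightarrow> 'c" where
  "at_theta emb \<theta> = fract_lift (\<lambda>g. poly (map_poly emb g) \<theta>)"

definition base_change :: "('f::field \<Rightarrow> 'c::field) \<Rightarrow> 'f poly fract \<Rightarrow> 'c poly fract" where
  "base_change emb = fract_lift (\<lambda>g. to_fract (map_poly emb g))"

text \<open>\<open>coeff_power n g\<close> raises the coefficients of \<open>g\<close> to the \<open>n\<close>-th power, where \<open>n\<close> is
  meant to be a power of the characteristic.\<close>

definition coeff_power :: "nat \<Rightarrow> 'c::field poly fract \<Rightarrow> 'c poly fract" where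
  "coeff_power n = fract_lift (\<lambda>g. to_fract (map_poly (\<lambda>c. c ^ n) g))"


section \<open>The ring of functions regular away from one place\<close>

text \<open>The places of \<open>\<P>\<^sup>1\<close> over \<open>'f\<close> are the irreducible polynomials up to associates, and infinity.\<close>

definition regular_at :: "'f::field poly \<Rightarrow> 'f poly fract \<Rightarrow> bool" where
  "regular_at \<pi> a \<longleftrightarrow> (\<exists>g h. \<not> \<pi> dvd h \<and> a = Fract g h)"

definition regular_at_infinity :: "'f::field poly fract \<Rightarrow> bool" where
  "regular_at_infinity a \<longleftrightarrow> (\<exists>g h. h \<noteq> 0 \<and> degree g \<le> degree h \<and> a = Fract g h)"

definition ring_away :: "'f::field poly \<Rightarrow> 'f poly fract set" where
  "ring_away \<rho> =
     {a. (\<forall>\<pi>. irreducible \<pi> \<and> \<not> \<pi> dvd \<rho> \<longrightarrow> regular_at \<pi> a) \<and> regular_at_infinity a}"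


section \<open>The completion of an algebraic closure of the local field\<close>

definition algebraic_over :: "'c::field set \<Rightarrow> 'c \<Rightarrow> bool" where
  "algebraic_over S x \<longleftrightarrow> (\<exists>p. p \<noteq> 0 \<and> (\<forall>i. coeff p i \<in> S) \<and> poly p x = 0)"

definition K_rho :: "('f::field \<Rightarrow> 'c::{field,complete_space}) \<Rightarrow> 'c \<Rightarrow> 'c set" where
  "K_rho emb \<theta> = closure (range (at_theta emb \<theta>))"

definition K_rho_bar :: "('f::field \<Rightarrow> 'c::{field,complete_space}) \<Rightarrow> 'c \<Rightarrow> 'c set" where
  "K_rho_bar emb \<theta> = {x. algebraic_over (K_rho emb \<theta>) x}"

text \<open>
  The type \<open>'c\<close> is a completion of an algebraic closure of the completion of \<open>\<F>\<^sub>q(\<theta>)\<close> at the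
  place \<open>\<rho>(\<theta>)\<close>. Completeness of \<open>'c\<close> is part of its sort, so that the closure of \<open>\<F>\<^sub>q(\<theta>)\<close> in \<open>'c\<close>
  is a completion.
\<close>

locale rho_adic_C_infinity =
  fixes absv :: "'c::{field,complete_space} \<Rightarrow> real"
    and emb :: "'f::{field,finite} \<Rightarrow> 'c"
    and \<rho> :: "'f poly"
    and \<theta> :: 'c
  assumes dist_absv: "dist x y = absv (x - y)"
    and absv_mult: "absv (x * y) = absv x * absv y"
    and absv_add: "absv (x + y) \<le> max (absv x) (absv y)"
    and emb_1: "emb 1 = 1"
    and emb_add: "emb (a + b) = emb a + emb b"
    and emb_mult: "emb (a * b) = emb a * emb b"
    and absv_rho_adic: "\<not> \<rho> dvd g \<Longrightarrow>
          absv (poly (map_poly emb (\<rho> ^ n * g)) \<theta>) = (1 / real CARD('f)) ^ n"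
    and K_rho_bar_alg_closed:
          "\<lbrakk>degree p > 0; \<forall>i. coeff p i \<in> K_rho_bar emb \<theta>\<rbrakk>
             \<Longrightarrow> \<exists>x \<in> K_rho_bar emb \<theta>. poly p x = 0"
    and K_rho_bar_dense: "closure (K_rho_bar emb \<theta>) = UNIV"


section \<open>The module \<open>\<Psi>\<close>\<close>

definition f_fun :: "'c::field \<Rightarrow> 'c \<Rightarrow> 'c poly fract" where
  "f_fun \<theta> \<eta> = 1 / to_fract [:- \<eta>, 1:] - to_fract [:1 / (\<theta> - \<eta>):]"

definition s_fun :: "nat \<Rightarrow> 'c::field \<Rightarrow> 'c \<Rightarrow> nat \<Rightarrow> 'c poly fract" where
  "s_fun q \<theta> \<eta> i = (\<Prod>k<i. coeff_power (q ^ k) (f_fun \<theta> \<eta>))"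

text \<open>
  A twisted polynomial \<open>\<Sum>\<^sub>i c\<^sub>i \<tau>\<^sup>i\<close> is represented by the element of \<open>'c poly\<close> with the same
  coefficients; the commutative multiplication of \<open>'c poly\<close> plays no role.
\<close>

definition Psi :: "('f::{field,finite} \<Rightarrow> 'c::field) \<Rightarrow> 'c \<Rightarrow> 'c \<Rightarrow> 'f poly fract \<Rightarrow> 'c poly" where
  "Psi emb \<theta> \<eta> a = (THE P.
     base_change emb a = (\<Sum>i\<le>degree P. to_fract [:coeff P i:] * s_fun CARD('f) \<theta> \<eta> i))"

definition tau_eval :: "nat \<Rightarrow> 'c::field poly \<Rightarrow> 'c \<Rightarrow> 'c" where
  "tau_eval q P z = (\<Sum>i\<le>degree P. coeff P i * z ^ (q ^ i))"


section \<open>Exponential and logarithm\<close>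

definition Fq_linear :: "('f::field \<Rightarrow> 'c::field) \<Rightarrow> ('c \<Rightarrow> 'c) \<Rightarrow> bool" where
  "Fq_linear emb e \<longleftrightarrow>
     (\<forall>x y. e (x + y) = e x + e y) \<and> (\<forall>a x. e (emb a * x) = emb a * e x)"

definition is_exponential ::
  "('f::{field,finite} \<Rightarrow> 'c::{field,complete_space}) \<Rightarrow> 'f poly \<Rightarrow> 'c \<Rightarrow> 'c \<Rightarrow> ('c \<Rightarrow> 'c) \<Rightarrow> bool"
  where
  "is_exponential emb \<rho> \<theta> \<eta> e \<longleftrightarrow>
     Fq_linear emb e \<and>
     ((\<lambda>h. (e h - e 0) / h) \<longlongrightarrow> 1) (at 0) \<and>
     (\<forall>a \<in> ring_away \<rho>. \<forall>\<xi>.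
        tau_eval CARD('f) (Psi emb \<theta> \<eta> a) (e \<xi>) = e (at_theta emb \<theta> a * \<xi>))"

definition exp0 ::
  "('f::{field,finite} \<Rightarrow> 'c::{field,complete_space}) \<Rightarrow> 'f poly \<Rightarrow> 'c \<Rightarrow> 'c \<Rightarrow> 'c \<Rightarrow> 'c" where
  "exp0 emb \<rho> \<theta> \<eta> = (THE e. is_exponential emb \<rho> \<theta> \<eta> e)"

text \<open>The power series of \<open>exp0\<close> and its compositional inverse.\<close>

definition exp0_series ::
  "('f::{field,finite} \<Rightarrow> 'c::{field,complete_space}) \<Rightarrow> 'f poly \<Rightarrow> 'c \<Rightarrow> 'c \<Rightarrow> 'c fps" where
  "exp0_series emb \<rho> \<theta> \<eta> = (THE F. \<forall>\<xi>. (\<lambda>n. fps_nth F n * \<xi> ^ n) sums exp0 emb \<rho> \<theta> \<eta> \<xi>)"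

definition log0_series ::
  "('f::{field,finite} \<Rightarrow> 'c::{field,complete_space}) \<Rightarrow> 'f poly \<Rightarrow> 'c \<Rightarrow> 'c \<Rightarrow> 'c fps" where
  "log0_series emb \<rho> \<theta> \<eta> = fps_inv (exp0_series emb \<rho> \<theta> \<eta>)"

text \<open>The function defined by \<open>log0_series\<close>; it is meaningful only near \<open>0\<close>.\<close>

definition log0 ::
  "('f::{field,finite} \<Rightarrow> 'c::{field,complete_space}) \<Rightarrow> 'f poly \<Rightarrow> 'c \<Rightarrow> 'c \<Rightarrow> 'c \<Rightarrow> 'c" where
  "log0 emb \<rho> \<theta> \<eta> \<xi> = (\<Sum>n. fps_nth (log0_series emb \<rho> \<theta> \<eta>) n * \<xi> ^ n)"


section \<open>The coefficients\<close>

text \<open>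
  \<open>frob_conj q N \<eta> i\<close> is \<open>\<eta>\<close> raised to the power \<open>q\<^sup>i\<close> for an integer \<open>i\<close>, where \<open>\<eta>\<close> lies in the
  field with \<open>q\<^sup>N\<close> elements.
\<close>

definition frob_conj :: "nat \<Rightarrow> nat \<Rightarrow> 'c::field \<Rightarrow> int \<Rightarrow> 'c" where
  "frob_conj q N \<eta> i = \<eta> ^ (q ^ nat (i mod int N))"

primrec D_coeff :: "nat \<Rightarrow> 'c::field \<Rightarrow> 'c \<Rightarrow> nat \<Rightarrow> 'c" where
  "D_coeff q \<theta> \<eta> 0 = 1"
| "D_coeff q \<theta> \<eta> (Suc i) =
     D_coeff q \<theta> \<eta> i ^ q *
     ((\<theta> - \<theta> ^ (q ^ Suc i)) / ((\<theta> ^ (q ^ Suc i) - \<eta>) * (\<theta> - \<eta>)))"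

primrec L_coeff :: "nat \<Rightarrow> nat \<Rightarrow> 'c::field \<Rightarrow> 'c \<Rightarrow> nat \<Rightarrow> 'c" where
  "L_coeff q N \<theta> \<eta> 0 = 1"
| "L_coeff q N \<theta> \<eta> (Suc j) =
     L_coeff q N \<theta> \<eta> j *
     ((\<theta> - \<theta> ^ (q ^ Suc j)) /
      ((\<theta> - frob_conj q N \<eta> (int (Suc j) - 2)) * (\<theta> - \<eta>) ^ (q ^ j) *
       (\<theta> - frob_conj q N \<eta> (- 1)) ^ (q ^ Suc j - q ^ j)))"

end

theory Submission
  imports Defs
begin

text \<open>
  Everything is read off from values at the points \<open>t = \<theta>\<^bsup>q^k\<^esup>\<close>. The function \<open>s\<^sub>i\<close> vanishes there for
  \<open>i > k\<close> and equals \<open>D\<^sub>k / D\<^bsub>k-i\<^esub>\<^bsup>q^i\<^esup>\<close> for \<open>i \<le> k\<close>. Hence the coefficients \<open>c\<^sub>i\<close> of \<open>\<Psi>\<^sub>a\<close> are unique, and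
  evaluating \<open>a = \<Sum>\<^sub>i c\<^sub>i s\<^sub>i\<close> at \<open>\<theta>\<^bsup>q^k\<^esup>\<close> gives \<open>\<Sum>\<^sub>i c\<^sub>i / D\<^bsub>k-i\<^esub>\<^bsup>q^i\<^esup> = a(\<theta>)\<^bsup>q^k\<^esup> / D\<^sub>k\<close>, which is the functional equation of
  the exponential compared coefficient by coefficient. The series is entire since \<open>\<bar>D\<^sub>i\<bar>\<close> is at least
  \<open>q\<close> to the power \<open>\<lfloor>i / N\<rfloor> q\<^sup>i\<close>.

  For the logarithm put \<open>l\<^sub>i = (-1)\<^sup>i / L\<^sub>i\<close>. The sum \<open>\<Sum>\<^bsub>i\<le>n\<^esub> l\<^sub>i s\<^sub>i\<close> has a closed form with zeros
  \<open>\<theta>\<^bsup>q^k\<^esup>\<close> for \<open>1 \<le> k \<le> n\<close>. Evaluated at \<open>\<theta>\<^bsup>q^n\<^esup>\<close> it says that the series with coefficients \<open>l\<^sub>i\<close> is a left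
  inverse of the exponential series with respect to composition.
\<close>

section \<open>Finite fields and the Frobenius map\<close>

text \<open>Multiplication by a nonzero \<open>x\<close> permutes the nonzero elements of
  \<open>S\<close>; comparing the products over them cancels to \<open>x ^ (card S - 1) = 1\<close>.
  Working with a subset covers both the type \<open>'f\<close> and the field \<open>residues\<close>
  inside \<open>'c\<close>.\<close>

lemma power_card_eq_self:
  fixes x :: "'a::field"
  assumes "finite S" "x \<in> S" "0 \<in> S" and closed: "\<And>y. y \<in> S \<Longrightarrow> x * y \<in> S"
  shows "x ^ card S = x"
proof (cases "x = 0")
  case True
  then show ?thesis using assms by (auto simp: power_0_left)
next
  case False
  let ?S = "S - {0}"
  have inj: "inj_on ((*) x) ?S" using False by (auto simp: inj_on_def)
  have surj: "(*) x ` ?S = ?S"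
  proof (rule endo_inj_surj)
    show "(*) x ` ?S \<subseteq> ?S"
    proof (rule image_subsetI)
      fix y assume "y \<in> ?S"
      then show "x * y \<in> ?S" using closed[of y] False by simp
    qed
  qed (use assms(1) inj in simp_all)
  have "(\<Prod>y\<in>?S. y) = (\<Prod>y\<in>?S. x * y)"
    using prod.reindex[OF inj, of "\<lambda>y. y"] unfolding surj o_def .
  also have "\<dots> = x ^ card ?S * (\<Prod>y\<in>?S. y)" by (simp add: prod.distrib)
  finally have "x ^ card ?S = 1" using assms by simp
  then have "x ^ Suc (card ?S) = x" by simp
  moreover have "Suc (card ?S) = card S"
    using assms by (intro card.remove[symmetric])
  ultimately show ?thesis by simp
qed

lemma finite_field_power_card: "(x::'f::{field,finite}) ^ CARD('f) = x"
  by (rule power_card_eq_self) auto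

lemma card_field_ge_2: "CARD('f::{field,finite}) \<ge> 2"
proof -
  have "card {0, 1 :: 'f} \<le> CARD('f)" by (intro card_mono) auto
  then show ?thesis by simp
qed

text \<open>Since \<open>x ^ q = x\<close> on the whole field, the middle terms of
  \<open>(x + 1) ^ q\<close> define a polynomial of degree below \<open>q\<close> with
  \<open>q\<close> roots, hence zero. This bypasses the fact that \<open>q\<close> is a prime
  power.\<close>

lemma of_nat_card_choose:
  assumes "0 < k" "k < CARD('f::{field,finite})"
  shows "of_nat (CARD('f) choose k) = (0 :: 'f)"
proof -
  let ?q = "CARD('f)"
  define p :: "'f poly" where "p = (\<Sum>i\<in>{0<..<?q}. monom (of_nat (?q choose i)) i)"
  have "poly p x = 0" for x
  proof -
    have "(x + 1) ^ ?q = (\<Sum>i\<le>?q. of_nat (?q choose i) * x ^ i)"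
      by (simp add: binomial_ring)
    also have "{..?q} = insert 0 (insert ?q {0<..<?q})"
      using card_field_ge_2[where 'f='f] by auto
    also have "(\<Sum>i\<in>\<dots>. of_nat (?q choose i) * x ^ i) = 1 + (x ^ ?q + poly p x)"
      using card_field_ge_2[where 'f='f] by (simp add: p_def poly_sum poly_monom)
    finally show ?thesis by (simp add: finite_field_power_card)
  qed
  moreover have "degree p < ?q"
    using card_field_ge_2[where 'f='f]
    by (auto simp: p_def intro!: degree_sum_less le_less_trans[OF degree_monom_le])
  ultimately have "p = 0"
    using card_field_ge_2[where 'f='f] by (intro poly_eqI_degree[of UNIV]) auto
  then have "coeff p k = 0" by simp
  then show ?thesis using assms by (simp add: p_def coeff_sum sum.delta')
qed

text \<open>By \<open>of_nat_card_choose\<close> only the outer binomial terms survive. The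
  assumption \<open>char\<close> transfers the vanishing of integers, so that the result applies to
  \<open>'c\<close> as well as to power series over it.\<close>

lemma frobenius_add_of_field:
  fixes x y :: "'a::comm_semiring_1"
  assumes char: "\<And>n. of_nat n = (0::'f::{field,finite}) \<Longrightarrow> of_nat n = (0::'a)"
  shows "(x + y) ^ CARD('f) = x ^ CARD('f) + y ^ CARD('f)"
proof -
  let ?q = "CARD('f)"
  have "(x + y) ^ ?q = (\<Sum>k\<le>?q. of_nat (?q choose k) * x ^ k * y ^ (?q - k))"
    by (rule binomial_ring)
  also have "\<dots> = (\<Sum>k\<in>{0,?q}. of_nat (?q choose k) * x ^ k * y ^ (?q - k))"
    by (intro sum.mono_neutral_right ballI)
       (auto simp: char[OF of_nat_card_choose])
  finally show ?thesis by (simp add: add_ac)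
qed

lemma frobenius_power_add_of_field:
  fixes x y :: "'a::comm_semiring_1"
  assumes char: "\<And>n. of_nat n = (0::'f::{field,finite}) \<Longrightarrow> of_nat n = (0::'a)"
  shows "(x + y) ^ (CARD('f) ^ i) = x ^ (CARD('f) ^ i) + y ^ (CARD('f) ^ i)"
proof (induction i arbitrary: x y)
  case (Suc i)
  have "(x + y) ^ (CARD('f) ^ Suc i) = ((x + y) ^ CARD('f)) ^ (CARD('f) ^ i)"
    by (simp add: power_mult)
  also have "(x + y) ^ CARD('f) = x ^ CARD('f) + y ^ CARD('f)"
    by (rule frobenius_add_of_field[OF char])
  finally show ?case using Suc by (simp add: power_mult)
qed simp

lemma map_poly_sum_mult:
  fixes h :: "'a::comm_semiring_0 \<Rightarrow> 'b::comm_semiring_0"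
  assumes "h 0 = 0" "\<And>x y. h (x + y) = h x + h y" "\<And>x y. h (x * y) = h x * h y"
  shows "map_poly h (p + r) = map_poly h p + map_poly h r"
    and "map_poly h (p * r) = map_poly h p * map_poly h r"
proof -
  have s: "h (sum g A) = (\<Sum>i\<in>A. h (g i))" for g :: "nat \<Rightarrow> 'a" and A
    by (induction A rule: infinite_finite_induct) (auto simp: assms)
  show "map_poly h (p + r) = map_poly h p + map_poly h r"
    by (rule poly_eqI) (simp add: coeff_map_poly assms)
  show "map_poly h (p * r) = map_poly h p * map_poly h r"
    by (rule poly_eqI) (simp add: coeff_map_poly assms coeff_mult s)
qed

text \<open>Such polynomials correspond to coefficient lists of length \<open>n\<close>. For
  \<open>n = 0\<close> the set is empty, because \<open>degree 0 = 0\<close>, whereas there is one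
  empty list.\<close>

lemma card_poly_degree_less: "card {g :: 'f::{field,finite} poly. degree g < n} = CARD('f) ^ n"
  if "n > 0"
proof -
  let ?X = "{xs :: 'f list. set xs \<subseteq> UNIV \<and> length xs = n}"
  have "bij_betw Poly ?X {g. degree g < n}"
  proof (rule bij_betwI[where g = "\<lambda>g. map (coeff g) [0..<n]"])
    show "Poly \<in> ?X \<rightarrow> {g. degree g < n}"
    proof
      fix xs :: "'f list" assume "xs \<in> ?X"
      then have "degree (Poly xs) \<le> n - 1"
        by (intro degree_le) (auto simp: nth_default_def)
      then show "Poly xs \<in> {g. degree g < n}" using that by auto
    qed
    show "(\<lambda>g. map (coeff g) [0..<n]) \<in> {g. degree g < n} \<rightarrow> ?X" by auto
    show "map (coeff (Poly xs)) [0..<n] = xs" if "xs \<in> ?X" for xs :: "'f list"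
      by (rule nth_equalityI) (use that in \<open>auto simp: nth_default_def\<close>)
    show "Poly (map (coeff g) [0..<n]) = g" if "g \<in> {g. degree g < n}" for g :: "'f poly"
      by (rule poly_eqI) (use that in \<open>auto simp: nth_default_def coeff_eq_0\<close>)
  qed
  then have "card ?X = card {g :: 'f poly. degree g < n}" by (rule bij_betw_same_card)
  then show ?thesis using card_lists_length_eq[of "UNIV :: 'f set" n] by simp
qed

section \<open>The embedding of the constants and the absolute value\<close>

locale rho_adic_root = rho_adic_C_infinity absv emb \<rho> \<theta>
  for absv :: "'c::{field,complete_space} \<Rightarrow> real"
    and emb :: "'f::{field,finite} \<Rightarrow> 'c"
    and \<rho> :: "'f poly"
    and \<theta> :: 'c +
  fixes \<eta> :: 'c and q N :: nat
  assumes q_def: "q = CARD('f)" and N_def: "N = degree \<rho>"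
    and monic: "lead_coeff \<rho> = 1"
    and irred: "irreducible \<rho>"
    and N_ge_2: "N \<ge> 2"
    and root: "poly (map_poly emb \<rho>) \<eta> = 0"
    and absv_pi: "absv (\<theta> - \<eta>) = 1 / real q"
begin

lemma q_ge_2: "q \<ge> 2" using card_field_ge_2[where 'f='f] by (simp add: q_def)

lemma q_pos [simp]: "q > 0" "q \<noteq> 0" using q_ge_2 by simp_all

lemma emb_0 [simp]: "emb 0 = 0"
  using emb_add[of 0 0] by (metis add.right_neutral add_left_cancel)

lemma emb_eq_0_iff [simp]: "emb a = 0 \<longleftrightarrow> a = 0"
proof
  assume a: "emb a = 0"
  show "a = 0"
  proof (rule ccontr)
    assume "a \<noteq> 0"
    then have "emb (a * inverse a) = 1" by (simp add: emb_1)
    then show False by (simp add: emb_mult a)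
  qed
qed simp

lemma emb_of_nat: "emb (of_nat n) = of_nat n"
  by (induction n) (simp_all add: emb_add emb_1)

lemma emb_power: "emb (a ^ n) = emb a ^ n"
  by (induction n) (simp_all add: emb_mult emb_1)

lemma emb_power_q: "emb a ^ (q ^ i) = emb a"
proof (induction i)
  case (Suc i)
  have "emb a ^ (q ^ Suc i) = (emb a ^ q) ^ (q ^ i)" by (simp add: power_mult)
  also have "emb a ^ q = emb (a ^ q)" by (simp only: emb_power)
  also have "\<dots> = emb a" by (simp only: finite_field_power_card q_def)
  finally show ?case using Suc by simp
qed simp

lemma of_nat_eq_0_transfer:
  assumes "of_nat n = (0::'f)"
  shows "of_nat n = (0::'c)"
  using emb_of_nat[of n] assms by simp

lemma frob_add: "(x + y :: 'c) ^ (q ^ i) = x ^ (q ^ i) + y ^ (q ^ i)"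
  unfolding q_def by (rule frobenius_power_add_of_field[OF of_nat_eq_0_transfer])

lemma frob_fps_add: "(x + y :: 'c fps) ^ (q ^ i) = x ^ (q ^ i) + y ^ (q ^ i)"
  unfolding q_def
  by (rule frobenius_power_add_of_field)
     (simp only: fps_of_nat[symmetric] of_nat_eq_0_transfer fps_const_0_eq_0)

lemma frob_minus: "(- x :: 'c) ^ (q ^ i) = - (x ^ (q ^ i))"
proof -
  have "(x + (- x)) ^ (q ^ i) = x ^ (q ^ i) + (- x) ^ (q ^ i)" by (rule frob_add)
  then show ?thesis by (simp add: power_0_left eq_neg_iff_add_eq_0 add.commute)
qed

lemma frob_diff: "(x - y :: 'c) ^ (q ^ i) = x ^ (q ^ i) - y ^ (q ^ i)"
  using frob_add[of x "- y" i] by (simp add: frob_minus)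

lemma frob_sum: "(sum g A :: 'c) ^ (q ^ i) = (\<Sum>x\<in>A. g x ^ (q ^ i))"
  by (induction A rule: infinite_finite_induct) (simp_all add: frob_add power_0_left)

lemma frob_inj: "(x :: 'c) ^ (q ^ i) = y ^ (q ^ i) \<Longrightarrow> x = y"
  using frob_diff[of x y i] by (metis eq_iff_diff_eq_0 power_eq_0_iff)

lemma map_emb_add: "map_poly emb (g + h) = map_poly emb g + map_poly emb h"
  and map_emb_mult: "map_poly emb (g * h) = map_poly emb g * map_poly emb h"
  by (intro map_poly_sum_mult; simp add: emb_add emb_mult)+

lemma map_emb_diff: "map_poly emb (g - h) = map_poly emb g - map_poly emb h"
  using map_emb_add[of "g - h" h] by simp

lemma map_emb_eq_0_iff [simp]: "map_poly emb g = 0 \<longleftrightarrow> g = 0"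
  by (simp add: poly_eq_iff coeff_map_poly)

lemma degree_map_emb [simp]: "degree (map_poly emb g) = degree g"
  by (intro degree_map_poly) simp

lemma frob_poly_emb: "poly (map_poly emb g) x ^ (q ^ i) = poly (map_poly emb g) (x ^ (q ^ i))"
  by (simp add: poly_altdef frob_sum coeff_map_poly power_mult_distrib emb_power_q
      flip: power_mult add: mult.commute)

section \<open>Ultrametric properties of the absolute value\<close>

lemma absv_0 [simp]: "absv 0 = 0"
  using dist_absv[of 0 0] by simp

lemma absv_nonneg [simp]: "absv x \<ge> 0"
  using dist_absv[of x 0] by (metis diff_zero zero_le_dist)

lemma absv_eq_0_iff [simp]: "absv x = 0 \<longleftrightarrow> x = 0"
  using dist_absv[of x 0] by (metis diff_zero dist_eq_0_iff)

lemma absv_pos_iff [simp]: "absv x > 0 \<longleftrightarrow> x \<noteq> 0"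
  using absv_nonneg[of x] absv_eq_0_iff[of x] by linarith

lemma absv_1 [simp]: "absv 1 = 1"
proof -
  have "absv 1 * absv 1 = absv 1 * 1" by (simp flip: absv_mult)
  moreover have "absv 1 \<noteq> 0" by (simp only: absv_eq_0_iff) simp
  ultimately show ?thesis by (simp only: mult_cancel_left) simp
qed

lemma absv_power: "absv (x ^ n) = absv x ^ n"
  by (induction n) (simp_all add: absv_mult)

lemma absv_minus_commute: "absv (x - y) = absv (y - x)"
  using dist_commute[of x y] by (simp only: dist_absv)

lemma absv_minus [simp]: "absv (- x) = absv x"
  using absv_minus_commute[of 0 x] by simp

lemma absv_diff: "absv (x - y) \<le> max (absv x) (absv y)"
  using absv_add[of x "- y"] by simp

lemma absv_inverse: "absv (inverse x) = inverse (absv x)"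
proof (cases "x = 0")
  case False
  have "absv (inverse x) * absv x = 1" by (simp flip: absv_mult add: False)
  then show ?thesis using False by (simp add: field_simps)
qed simp

lemma absv_divide: "absv (x / y) = absv x / absv y"
  by (simp add: field_class.field_divide_inverse absv_mult absv_inverse divide_inverse)

lemma absv_add_eq:
  assumes "absv y < absv x"
  shows "absv (x + y) = absv x"
proof (rule antisym)
  show "absv (x + y) \<le> absv x" using absv_add[of x y] assms by simp
  show "absv x \<le> absv (x + y)" using absv_diff[of "x + y" y] assms by (simp add: max_def split: if_splits)
qed

lemma absv_sum_le:
  assumes "\<And>i. i \<in> A \<Longrightarrow> absv (g i) \<le> B" "B \<ge> 0"
  shows "absv (sum g A) \<le> B"
  using assms
proof (induction A rule: infinite_finite_induct)
  case (insert x A)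
  then have "absv (sum g A) \<le> B" "absv (g x) \<le> B" by simp_all
  then have "absv (g x + sum g A) \<le> B" using absv_add[of "g x" "sum g A"] by linarith
  then show ?case using insert by simp
qed simp_all

text \<open>Nonzero elements of a finite field are roots of unity. Applied to differences of
  conjugates of \<open>\<eta>\<close>, this makes distinct conjugates have distance 1.\<close>

lemma absv_fixed_frob:
  assumes "u ^ (q ^ n) = u" "u \<noteq> 0" "n > 0"
  shows "absv u = 1"
proof -
  have "q ^ n > 1" using q_ge_2 assms by (intro one_less_power) auto
  have "absv u ^ (q ^ n) = absv u" using assms by (simp flip: absv_power)
  moreover have "absv u ^ (q ^ n) = absv u * absv u ^ (q ^ n - 1)"
    by (simp flip: power_Suc)
  ultimately have "absv u ^ (q ^ n - 1) = 1" using assms by simp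
  then have "absv u ^ (q ^ n - 1) = 1 ^ (q ^ n - 1)" by simp
  then show ?thesis
    using \<open>q ^ n > 1\<close> power_eq_iff_eq_base[of "q ^ n - 1" "absv u" 1] by simp
qed

section \<open>The residue field\<close>


abbreviation eta :: "nat \<Rightarrow> 'c" where "eta i \<equiv> \<eta> ^ (q ^ i)"
abbreviation th :: "nat \<Rightarrow> 'c" where "th i \<equiv> \<theta> ^ (q ^ i)"

lemma rho_nonzero: "\<rho> \<noteq> 0" using monic by auto

text \<open>Division with remainder shows that a nonzero polynomial \<open>m\<close> of least degree
  vanishing at \<open>\<eta>\<close> divides every other one. It is a nonunit dividing the
  irreducible \<open>\<rho>\<close>, hence associated to \<open>\<rho>\<close>.\<close>

lemma poly_eta_eq_0_iff: "poly (map_poly emb g) \<eta> = 0 \<longleftrightarrow> \<rho> dvd g"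
proof
  assume "\<rho> dvd g"
  then show "poly (map_poly emb g) \<eta> = 0"
    using root by (auto simp: map_emb_mult elim!: dvdE)
next
  assume g: "poly (map_poly emb g) \<eta> = 0"
  let ?I = "\<lambda>m. m \<noteq> 0 \<and> poly (map_poly emb m) \<eta> = 0"
  define m where "m = arg_min degree ?I"
  have I: "?I \<rho>" using rho_nonzero root by simp
  have m: "?I m" unfolding m_def using arg_min_natI[of ?I, OF I] .
  have dvd: "m dvd h" if h: "poly (map_poly emb h) \<eta> = 0" for h
  proof -
    have "h mod m = h - h div m * m" by (simp add: minus_div_mult_eq_mod)
    then have r: "poly (map_poly emb (h mod m)) \<eta> = 0"
      using m h by (simp add: map_emb_diff map_emb_mult)
    show ?thesis
    proof (cases "h mod m = 0")
      case False
      then have "degree (h mod m) < degree m" using m degree_mod_less[of m h] by blast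
      moreover have "degree m \<le> degree (h mod m)"
        using arg_min_nat_le[of ?I "h mod m" degree, folded m_def] False r by blast
      ultimately show ?thesis by simp
    qed (simp add: mod_eq_0_iff_dvd)
  qed
  have "\<not> is_unit m"
  proof
    assume "is_unit m"
    then obtain c where "m = [:c:]" by (auto simp: is_unit_poly_iff)
    then show False using m by (simp add: map_poly_pCons)
  qed
  moreover obtain k where k: "\<rho> = m * k" using dvd[OF root] by blast
  ultimately have "is_unit k" using irreducibleD[OF irred k] by blast
  then have "\<rho> dvd m" using k by simp
  then show "\<rho> dvd g" using dvd[OF g] dvd_trans by blast
qed

text \<open>This is the field generated by \<open>\<eta>\<close> over the constants, parametrized by
  remainders modulo \<open>\<rho>\<close> so that its \<open>q ^ N\<close> elements can be
  counted.\<close>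

definition residues where
  "residues = (\<lambda>g. poly (map_poly emb g) \<eta>) ` {g. degree g < N}"

lemma poly_eta_in_residues: "poly (map_poly emb g) \<eta> \<in> residues"
proof -
  have "g = g div \<rho> * \<rho> + g mod \<rho>" by simp
  then have "poly (map_poly emb g) \<eta> = poly (map_poly emb (g div \<rho> * \<rho> + g mod \<rho>)) \<eta>" by simp
  also have "\<dots> = poly (map_poly emb (g mod \<rho>)) \<eta>"
    by (simp only: map_emb_add map_emb_mult poly_add poly_mult root) simp
  finally have *: "poly (map_poly emb g) \<eta> = poly (map_poly emb (g mod \<rho>)) \<eta>" .
  have "degree (g mod \<rho>) < N"
    using degree_mod_less[OF rho_nonzero, of g] N_ge_2 by (auto simp: N_def)
  then show ?thesis unfolding residues_def using * by blast
qed

lemma card_residues: "card residues = q ^ N" "finite residues"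
proof -
  have "inj_on (\<lambda>g. poly (map_poly emb g) \<eta>) {g. degree g < N}"
  proof (rule inj_onI)
    fix g h assume gh: "g \<in> {g. degree g < N}" "h \<in> {g. degree g < N}"
      "poly (map_poly emb g) \<eta> = poly (map_poly emb h) \<eta>"
    then have "\<rho> dvd g - h" by (simp flip: poly_eta_eq_0_iff add: map_emb_diff)
    moreover have "degree (g - h) < degree \<rho>"
      using gh degree_diff_less[of g N h] by (simp add: N_def)
    ultimately show "g = h" using dvd_imp_degree_le[of \<rho> "g - h"] by auto
  qed
  then have "card residues = card {g :: 'f poly. degree g < N}"
    unfolding residues_def by (rule card_image)
  then show "card residues = q ^ N"
    using card_poly_degree_less[of N, where 'f='f] N_ge_2 by (simp add: q_def)
  then show "finite residues" using card_ge_0_finite by force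
qed

lemma residues_power: "x \<in> residues \<Longrightarrow> x ^ (q ^ N) = x"
proof -
  assume x: "x \<in> residues"
  have "0 \<in> residues" using poly_eta_in_residues[of 0] by simp
  moreover have "x * y \<in> residues" if y: "y \<in> residues" for y
  proof -
    obtain g h where "x = poly (map_poly emb g) \<eta>" "y = poly (map_poly emb h) \<eta>"
      using x y unfolding residues_def by blast
    then show ?thesis using poly_eta_in_residues[of "g * h"] by (simp add: map_emb_mult)
  qed
  ultimately show ?thesis
    using power_card_eq_self[of residues x] card_residues x by simp
qed

lemma eta_N: "eta N = \<eta>"
proof -
  have "poly (map_poly emb [:0, 1:]) \<eta> = \<eta>" by (simp add: map_poly_pCons emb_1)
  then show ?thesis using residues_power[of \<eta>] poly_eta_in_residues[of "[:0, 1:]"] by simp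
qed

section \<open>The conjugates of eta and the factorization of rho\<close>

lemma eta_add: "eta (i + j) = eta i ^ (q ^ j)"
  by (simp add: power_add power_mult)

lemma eta_mult_N: "eta (i + k * N) = eta i"
proof (induction k)
  case (Suc k)
  have "eta (i + Suc k * N) = eta (N + (i + k * N))" by (simp add: algebra_simps)
  also have "\<dots> = eta (i + k * N)" by (simp only: eta_add[of N] eta_N)
  finally show ?case using Suc by simp
qed simp

lemma eta_mod: "eta (i mod N) = eta i"
  using eta_mult_N[of "i mod N" "i div N"] by simp

lemma eta_fixed: "eta i ^ (q ^ N) = eta i"
  using eta_mult_N[of i 1] by (simp add: eta_add)

text \<open>If the \<open>q ^ d\<close> power fixed \<open>\<eta>\<close>, it would fix all of
  \<open>residues\<close>, and the polynomial \<open>X ^ (q ^ d) - X\<close> would have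
  \<open>q ^ N\<close> roots, more than its degree.\<close>

lemma eta_neq_of_lt:
  assumes "0 < d" "d < N"
  shows "eta d \<noteq> \<eta>"
proof
  assume d: "eta d = \<eta>"
  let ?p = "monom 1 (q ^ d) - monom 1 1 :: 'c poly"
  have gt: "q ^ d > 1" using q_ge_2 assms by (intro one_less_power) auto
  then have "q ^ d \<noteq> 1" by linarith
  then have "coeff ?p 1 = - 1" by (simp only: coeff_diff coeff_monom if_False simp_thms if_True diff_0)
  then have "?p \<noteq> 0" by (metis coeff_0 neg_equal_0_iff_equal zero_neq_one)
  have "residues \<subseteq> {x. poly ?p x = 0}"
    by (auto simp: residues_def poly_monom frob_poly_emb d)
  then have "card residues \<le> card {x. poly ?p x = 0}"
    using poly_roots_finite[OF \<open>?p \<noteq> 0\<close>] by (intro card_mono)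
  also have "\<dots> \<le> degree ?p" by (rule card_poly_roots_bound[OF \<open>?p \<noteq> 0\<close>])
  also have "\<dots> \<le> q ^ d"
    using gt by (intro degree_diff_le order.trans[OF degree_monom_le]) auto
  finally have "q ^ N \<le> q ^ d" by (simp add: card_residues)
  then show False using assms q_ge_2 by (simp add: power_le_imp_le_exp)
qed

lemma eta_eq_iff_lt: "i < j \<Longrightarrow> j < N \<Longrightarrow> eta i \<noteq> eta j"
proof
  assume "i < j" "j < N" and eq: "eta i = eta j"
  have "eta (j - i) ^ (q ^ i) = \<eta> ^ (q ^ i)"
    using eq \<open>i < j\<close> by (simp flip: eta_add)
  then have "eta (j - i) = \<eta>" by (rule frob_inj)
  then show False using eta_neq_of_lt[of "j - i"] \<open>i < j\<close> \<open>j < N\<close> by simp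
qed

lemma eta_eq_iff: "eta i = eta j \<longleftrightarrow> i mod N = j mod N"
proof
  assume "eta i = eta j"
  then have "eta (i mod N) = eta (j mod N)" by (simp only: eta_mod)
  moreover have "i mod N < N" "j mod N < N" using N_ge_2 by simp_all
  ultimately show "i mod N = j mod N" using eta_eq_iff_lt by (metis nat_neq_iff)
qed (metis eta_mod)

lemma inj_eta: "inj_on eta {..<N}"
  by (auto simp: inj_on_def eta_eq_iff)

lemma absv_eta_diff: "absv (eta i - eta j) = (if i mod N = j mod N then 0 else 1)"
proof -
  have "(eta i - eta j) ^ (q ^ N) = eta i - eta j" by (simp only: frob_diff eta_fixed)
  then show ?thesis
    using absv_fixed_frob[of "eta i - eta j" N] N_ge_2 by (auto simp: eta_eq_iff)
qed

text \<open>Both sides are monic of degree \<open>N\<close> and vanish at the \<open>N\<close>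
  distinct conjugates of \<open>\<eta>\<close>, which determines them.\<close>

lemma map_rho: "map_poly emb \<rho> = (\<Prod>i<N. [:- eta i, 1:])"
proof -
  let ?P = "\<Prod>i<N. [:- eta i, 1:]"
  have degP: "degree ?P = N" by (subst degree_prod_eq_sum_degree) auto
  have "lead_coeff ?P = 1" by (subst lead_coeff_prod) simp
  moreover have "coeff (map_poly emb \<rho>) N = 1"
    using monic by (simp add: coeff_map_poly N_def emb_1)
  ultimately show ?thesis
  proof (intro poly_eqI_degree_lead_coeff[where n = N and A = "eta ` {..<N}"])
    show "poly (map_poly emb \<rho>) x = poly ?P x" if x: "x \<in> eta ` {..<N}" for x
    proof -
      obtain i where i: "i < N" "x = eta i" using x by blast
      have "poly (map_poly emb \<rho>) (eta i) = 0"
        by (simp flip: frob_poly_emb add: root)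
      moreover have "poly ?P (eta i) = 0" using i by (auto simp: poly_prod)
      ultimately show ?thesis using i by simp
    qed
    show "N \<le> card (eta ` {..<N})" by (simp add: card_image inj_eta)
  qed (use degP in \<open>auto simp: N_def\<close>)
qed

section \<open>Distances between the Frobenius powers of theta and the conjugates of eta\<close>

lemma absv_pi_power: "absv ((\<theta> - \<eta>) ^ m) = (1 / real q) ^ m"
  by (simp only: absv_power absv_pi)

lemma q_inv_power_less_1: "m > 0 \<Longrightarrow> (1 / real q) ^ m < 1"
  using q_ge_2 by (subst power_less_one_iff) auto

text \<open>Expanding around \<open>eta k\<close> gives
  \<open>(eta k - eta i) + (\<theta> - \<eta>) ^ (q ^ k)\<close>. The first summand is 0 or has
  absolute value 1, and in the latter case it dominates.\<close>

lemma absv_th_minus_eta: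
  "absv (th k - eta i) = (if k mod N = i mod N then (1 / real q) ^ (q ^ k) else 1)"
proof -
  have *: "th k - eta i = (eta k - eta i) + (\<theta> - \<eta>) ^ (q ^ k)"
    by (simp add: frob_diff)
  show ?thesis
  proof (cases "k mod N = i mod N")
    case True
    then have "eta k = eta i" by (simp add: eta_eq_iff)
    then show ?thesis using True by (simp only: * absv_pi_power) (simp add: absv_pi_power)
  next
    case False
    have "absv ((\<theta> - \<eta>) ^ (q ^ k)) < absv (eta k - eta i)"
      using False by (simp only: absv_pi_power absv_eta_diff if_False) (rule q_inv_power_less_1, simp)
    then show ?thesis using False by (simp only: * absv_add_eq absv_eta_diff if_False)
  qed
qed

lemma th_neq_eta [simp]: "th k \<noteq> eta i"
proof -
  have "absv (th k - eta i) \<noteq> 0" by (simp only: absv_th_minus_eta) simp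
  then show ?thesis by auto
qed

lemma theta_neq_eta [simp]: "\<theta> \<noteq> \<eta>"
  using th_neq_eta[of 0 0] by simp

text \<open>Replacing \<open>th k\<close> by \<open>eta k\<close> changes the difference by
  \<open>(\<theta> - \<eta>) ^ (q ^ k)\<close>, which is smaller than \<open>1 / q\<close> because
  \<open>q ^ k > 1\<close>; so it is negligible even when \<open>eta k = \<eta>\<close>.\<close>

lemma absv_theta_minus_th:
  assumes "k > 0"
  shows "absv (\<theta> - th k) = (if k mod N = 0 then 1 / real q else 1)"
proof -
  have qk: "q ^ k > 1" using q_ge_2 assms by (intro one_less_power) auto
  have less: "absv (- ((\<theta> - \<eta>) ^ (q ^ k))) < absv (\<theta> - eta k)"
  proof -
    have "(1 / real q) ^ (q ^ k) < (1 / real q) ^ 1"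
      using q_ge_2 qk by (intro power_strict_decreasing) auto
    moreover have "(1 / real q) ^ (q ^ k) < 1" by (rule q_inv_power_less_1) simp
    ultimately show ?thesis
      using absv_th_minus_eta[of 0 k] by (auto simp: absv_pi_power)
  qed
  have "\<theta> - th k = (\<theta> - eta k) + - ((\<theta> - \<eta>) ^ (q ^ k))" by (simp add: frob_diff)
  then have "absv (\<theta> - th k) = absv (\<theta> - eta k)" by (simp only: absv_add_eq[OF less])
  then show ?thesis using absv_th_minus_eta[of 0 k] by simp
qed

lemma theta_neq_th: "k > 0 \<Longrightarrow> \<theta> \<noteq> th k"
proof -
  assume k: "k > 0"
  have "absv (\<theta> - th k) \<noteq> 0" by (simp only: absv_theta_minus_th[OF k]) simp
  then show ?thesis by auto
qed

lemma th_add: "th (i + j) = th i ^ (q ^ j)"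
  by (simp add: power_add power_mult)

lemma th_eq_iff [simp]: "th i = th j \<longleftrightarrow> i = j"
proof -
  have "th i \<noteq> th j" if "i < j" for i j
  proof
    assume eq: "th i = th j"
    have "th (j - i) ^ (q ^ i) = \<theta> ^ (q ^ i)" using eq that by (simp flip: th_add)
    then have "th (j - i) = \<theta>" by (rule frob_inj)
    then show False using theta_neq_th[of "j - i"] that zero_less_diff by metis
  qed
  then show ?thesis by (metis nat_neq_iff)
qed

end

section \<open>The ring of functions regular away from \<open>\<rho>\<close>\<close>

lemma irreducible_degree_pos: "irreducible (p :: 'a::field poly) \<Longrightarrow> degree p > 0"
  by (metis irreducible_def is_unit_iff_degree gr0I)

lemma exists_irreducible_dvd:
  fixes h :: "'a::field poly"
  assumes "degree h > 0"
  shows "\<exists>\<pi>. irreducible \<pi> \<and> \<pi> dvd h"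
  using assms
proof (induction "degree h" arbitrary: h rule: less_induct)
  case less
  show ?case
  proof (cases "irreducible h")
    case False
    have "h \<noteq> 0" using less.prems by auto
    moreover have "\<not> is_unit h" using less.prems is_unit_iff_degree[OF \<open>h \<noteq> 0\<close>] by linarith
    ultimately have "\<exists>a b. h = a * b \<and> \<not> is_unit a \<and> \<not> is_unit b"
      using False irreducibleI[of h] by auto
    then obtain a b where ab: "h = a * b" "\<not> is_unit a" "\<not> is_unit b" by (elim exE conjE)
    have "a \<noteq> 0" "b \<noteq> 0" using \<open>h \<noteq> 0\<close> unfolding ab(1) by auto
    then have "degree a > 0" "degree b > 0"
      using ab(2,3) is_unit_iff_degree[of a] is_unit_iff_degree[of b] by auto
    then have "degree a < degree h" using ab \<open>a \<noteq> 0\<close> \<open>b \<noteq> 0\<close> \<open>degree b > 0\<close> by (simp add: degree_mult_eq)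
    then obtain \<pi> where "irreducible \<pi>" "\<pi> dvd a"
      using less.hyps[of a] \<open>degree a > 0\<close> by blast
    then show ?thesis unfolding ab(1) using dvd_mult2 by blast
  qed auto
qed

lemma eq_smult_power_of_irreducible_dvd:
  fixes h :: "'a::field poly"
  assumes "irreducible \<rho>" "h \<noteq> 0" "\<And>\<pi>. irreducible \<pi> \<Longrightarrow> \<pi> dvd h \<Longrightarrow> \<pi> dvd \<rho>"
  shows "\<exists>c m. c \<noteq> 0 \<and> h = smult c (\<rho> ^ m)"
  using assms(2,3)
proof (induction "degree h" arbitrary: h rule: less_induct)
  case less
  show ?case
  proof (cases "degree h = 0")
    case True
    then obtain c where "h = [:c:]" by (rule degree_eq_zeroE)
    then show ?thesis using less.prems(1) by (intro exI[of _ c] exI[of _ 0]) simp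
  next
    case False
    then obtain \<pi> where \<pi>: "irreducible \<pi>" "\<pi> dvd h" using exists_irreducible_dvd by blast
    then have "\<pi> dvd \<rho>" by (rule less.prems(2))
    then have "\<rho> dvd \<pi>" using \<pi> assms(1) by (meson irreducible_altdef irreducible_not_unit)
    then have "\<rho> dvd h" using \<pi> dvd_trans by blast
    then obtain h1 where h1: "h = \<rho> * h1" by blast
    then have nz: "h1 \<noteq> 0" "\<rho> \<noteq> 0" using less.prems by auto
    then have "degree h1 < degree h"
      using h1 irreducible_degree_pos[OF assms(1)] by (simp add: degree_mult_eq)
    moreover have "\<pi>' dvd \<rho>" if "irreducible \<pi>'" "\<pi>' dvd h1" for \<pi>'
      using less.prems(2)[of \<pi>'] that h1 by simp
    ultimately obtain c m where "c \<noteq> 0" "h1 = smult c (\<rho> ^ m)"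
      using less.hyps[of h1] nz by blast
    then show ?thesis using h1 by (intro exI[of _ c] exI[of _ "Suc m"]) simp
  qed
qed

text \<open>A denominator of least degree takes the place of a reduced fraction: an irreducible
  divisor of it not dividing \<open>\<rho>\<close> would, by regularity, divide the numerator too
  and could be cancelled. Comparison with a representation that is regular at infinity bounds the
  degree of the numerator.\<close>

lemma ring_away_imp_Fract:
  assumes irr: "irreducible \<rho>" and a: "a \<in> ring_away \<rho>"
  shows "\<exists>g m. a = Fract g (\<rho> ^ m) \<and> degree g \<le> m * degree \<rho>"
proof -
  let ?I = "\<lambda>h. h \<noteq> 0 \<and> (\<exists>g. a = Fract g h)"
  obtain g\<^sub>0 h\<^sub>0 where *: "h\<^sub>0 \<noteq> 0" "degree g\<^sub>0 \<le> degree h\<^sub>0" "a = Fract g\<^sub>0 h\<^sub>0"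
    using a by (auto simp: ring_away_def regular_at_infinity_def)
  define h where "h = arg_min degree ?I"
  have "?I h" unfolding h_def by (rule arg_min_natI[of ?I h\<^sub>0]) (use * in blast)
  then obtain g where h: "h \<noteq> 0" "a = Fract g h" by blast
  have "\<pi> dvd \<rho>" if \<pi>: "irreducible \<pi>" "\<pi> dvd h" for \<pi>
  proof (rule ccontr)
    assume "\<not> \<pi> dvd \<rho>"
    then obtain g' h' where gh': "\<not> \<pi> dvd h'" "a = Fract g' h'"
      using a \<pi> by (auto simp: ring_away_def regular_at_def)
    then have "h' \<noteq> 0" by auto
    then have "g * h' = g' * h" using h gh' by (simp add: eq_fract)
    then have "\<pi> dvd g * h'" using \<pi> by simp
    then have "\<pi> dvd g"
      using prime_elem_dvd_multD[OF field_poly_irreducible_imp_prime[OF \<pi>(1)]] gh' by blast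
    then obtain g1 h1 where gh1: "g = \<pi> * g1" "h = \<pi> * h1" using \<pi> by (auto elim!: dvdE)
    then have nz: "h1 \<noteq> 0" "\<pi> \<noteq> 0" using h by auto
    then have "a = Fract g1 h1" using h gh1 by (simp add: eq_fract)
    then have "degree h \<le> degree h1"
      using arg_min_nat_le[of ?I h1 degree, folded h_def] nz by blast
    then show False using nz gh1 irreducible_degree_pos[OF \<pi>(1)] by (simp add: degree_mult_eq)
  qed
  then obtain c m where cm: "c \<noteq> 0" "h = smult c (\<rho> ^ m)"
    using eq_smult_power_of_irreducible_dvd[OF irr h(1)] by blast
  define g2 where "g2 = smult (inverse c) g"
  have \<rho>: "\<rho> \<noteq> 0" using irr by auto
  have a2: "a = Fract g2 (\<rho> ^ m)" using h cm \<rho> by (simp add: eq_fract g2_def)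
  then have "g2 * h\<^sub>0 = g\<^sub>0 * \<rho> ^ m" using * \<rho> by (simp add: eq_fract)
  then have "degree (g2 * h\<^sub>0) = degree (g\<^sub>0 * \<rho> ^ m)" by simp
  then have "degree g2 \<le> m * degree \<rho>"
  proof (cases "g2 = 0 \<or> g\<^sub>0 = 0")
    case True
    then have "g2 = 0" using \<open>g2 * h\<^sub>0 = g\<^sub>0 * \<rho> ^ m\<close> * by auto
    then show ?thesis by simp
  next
    case False
    then show ?thesis using \<open>degree (g2 * h\<^sub>0) = _\<close> * \<rho>
      by (simp add: degree_mult_eq degree_power_eq)
  qed
  then show ?thesis using a2 by blast
qed

lemma inverse_in_ring_away: "\<rho> \<noteq> 0 \<Longrightarrow> Fract 1 \<rho> \<in> ring_away \<rho>"
  unfolding ring_away_def regular_at_def regular_at_infinity_def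
  by (intro CollectI conjI allI impI exI[of _ 1] exI[of _ \<rho>]) auto

section \<open>The functions \<open>s\<^sub>i\<close>\<close>

context rho_adic_root
begin

text \<open>Written as one fraction, f is
  \<open>(\<theta> - t) / ((\<theta> - \<eta>) (t - \<eta>))\<close>; the Frobenius power can then
  be applied separately to numerator and denominator.\<close>

lemma coeff_power_f_fun:
  "coeff_power (q ^ k) (f_fun \<theta> \<eta>) =
     to_fract [:th k, - 1:] / to_fract (smult ((\<theta> - \<eta>) ^ (q ^ k)) [:- eta k, 1:])"
proof -
  let ?d = "smult (\<theta> - \<eta>) [:- \<eta>, 1:]"
  have nz: "?d \<noteq> 0" by simp
  have "f_fun \<theta> \<eta> * to_fract ?d = to_fract [:\<theta>, - 1:]"
  proof -
    have c: "?d = [:\<theta> - \<eta>:] * [:- \<eta>, 1:]" by simp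
    have "f_fun \<theta> \<eta> * to_fract ?d = to_fract [:\<theta> - \<eta>:]
        - to_fract ([:1 / (\<theta> - \<eta>):] * ([:\<theta> - \<eta>:] * [:- \<eta>, 1:]))"
      unfolding f_fun_def c left_diff_distrib by (simp only: to_fract_mult) simp
    also have "[:1 / (\<theta> - \<eta>):] * ([:\<theta> - \<eta>:] * [:- \<eta>, 1:]) = [:- \<eta>, 1:]"
      using theta_neq_eta by (simp add: field_simps)
    finally show ?thesis by (simp flip: to_fract_diff)
  qed
  then have f: "f_fun \<theta> \<eta> = Fract [:\<theta>, - 1:] ?d"
    using nz by (simp add: Fract_conv_to_fract eq_divide_eq del: smult_pCons)
  let ?\<phi> = "\<lambda>g. to_fract (map_poly (\<lambda>c::'c. c ^ (q ^ k)) g)"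
  have "fract_lift ?\<phi> (Fract [:\<theta>, - 1:] ?d) = ?\<phi> [:\<theta>, - 1:] / ?\<phi> ?d"
  proof (rule fract_lift_Fract)
    show "?\<phi> (x * y) = ?\<phi> x * ?\<phi> y" for x y
      by (subst map_poly_sum_mult) (simp_all add: power_0_left frob_add power_mult_distrib)
    show "?\<phi> x \<noteq> 0" if "x \<noteq> 0" for x
      using that by (auto simp: poly_eq_iff coeff_map_poly power_0_left)
  qed (use nz in simp)
  moreover have "map_poly (\<lambda>c::'c. c ^ (q ^ k)) [:\<theta>, - 1:] = [:th k, - 1:]"
    by (simp add: map_poly_pCons power_0_left frob_minus)
  moreover have "map_poly (\<lambda>c::'c. c ^ (q ^ k)) ?d = smult ((\<theta> - \<eta>) ^ (q ^ k)) [:- eta k, 1:]"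
    by (simp add: map_poly_pCons power_0_left frob_minus power_mult_distrib)
  ultimately show ?thesis unfolding f coeff_power_def by (simp only:)
qed

section \<open>Common denominators and values of combinations of the s_i\<close>

definition denom :: "nat \<Rightarrow> 'c poly" where
  "denom n = (\<Prod>k<n. [:- eta k, 1:])"

text \<open>The numerator of \<open>s_fun q \<theta> \<eta> i\<close> over the common denominator
  \<open>denom n\<close>, for \<open>i \<le> n\<close>; the second product consists of the factors
  of \<open>denom n\<close> absent from the denominator of s_i itself.\<close>

definition s_num :: "nat \<Rightarrow> nat \<Rightarrow> 'c poly" where
  "s_num i n = (\<Prod>k<i. smult (1 / (\<theta> - \<eta>) ^ (q ^ k)) [:th k, - 1:]) * (\<Prod>k=i..<n. [:- eta k, 1:])"

text \<open>The value of s_i at \<open>t = x\<close>, given directly as an element of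
  \<open>'c\<close> so that no evaluation of rational functions is required.\<close>

definition s_val :: "nat \<Rightarrow> 'c \<Rightarrow> 'c" where
  "s_val i x = (\<Prod>k<i. (th k - x) / ((\<theta> - \<eta>) ^ (q ^ k) * (x - eta k)))"

lemma denom_nonzero [simp]: "denom n \<noteq> 0"
  by (simp add: denom_def)

lemma s_fun_eq:
  assumes "i \<le> n"
  shows "s_fun CARD('f) \<theta> \<eta> i = to_fract (s_num i n) / to_fract (denom n)"
proof -
  have f: "coeff_power (q ^ k) (f_fun \<theta> \<eta>) =
      to_fract (smult (1 / (\<theta> - \<eta>) ^ (q ^ k)) [:th k, - 1:]) / to_fract [:- eta k, 1:]" for k
  proof -
    let ?c = "(\<theta> - \<eta>) ^ (q ^ k)"
    have "to_fract [:th k, - 1:] * to_fract [:- eta k, 1:] =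
      to_fract (smult (1 / ?c) [:th k, - 1:]) * to_fract (smult ?c [:- eta k, 1:])"
      using theta_neq_eta by (simp only: to_fract_mult[symmetric] mult_smult_left mult_smult_right) simp
    then show ?thesis
      unfolding coeff_power_f_fun using theta_neq_eta by (subst frac_eq_eq) simp_all
  qed
  have "s_fun CARD('f) \<theta> \<eta> i =
      to_fract (\<Prod>k<i. smult (1 / (\<theta> - \<eta>) ^ (q ^ k)) [:th k, - 1:]) / to_fract (denom i)"
  proof -
    have p: "to_fract (prod g A) = (\<Prod>k\<in>A. to_fract (g k))" for g :: "nat \<Rightarrow> 'c poly" and A
      by (induction A rule: infinite_finite_induct) auto
    show ?thesis unfolding s_fun_def denom_def p prod_dividef[symmetric] q_def[symmetric]
      by (intro prod.cong refl f)
  qed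
  moreover have "denom n = denom i * (\<Prod>k=i..<n. [:- eta k, 1:])"
    unfolding denom_def lessThan_atLeast0 using assms by (simp add: prod.atLeastLessThan_concat)
  moreover have "(\<Prod>k=i..<n. [:- eta k, 1:]) \<noteq> 0" by simp
  ultimately show ?thesis by (simp add: s_num_def)
qed

text \<open>The numerator of the sum of the \<open>c i\<close> times s_i over the common denominator
  \<open>denom n\<close>.\<close>

definition comb :: "(nat \<Rightarrow> 'c) \<Rightarrow> nat \<Rightarrow> 'c poly" where
  "comb c n = (\<Sum>i\<le>n. smult (c i) (s_num i n))"

lemma sum_s_fun_eq:
  assumes "degree P \<le> n"
  shows "(\<Sum>i\<le>degree P. to_fract [:coeff P i:] * s_fun CARD('f) \<theta> \<eta> i) =
           to_fract (comb (coeff P) n) / to_fract (denom n)"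
proof -
  have "(\<Sum>i\<le>degree P. to_fract [:coeff P i:] * s_fun CARD('f) \<theta> \<eta> i) =
        (\<Sum>i\<le>n. to_fract [:coeff P i:] * s_fun CARD('f) \<theta> \<eta> i)"
    using assms by (intro sum.mono_neutral_left) (auto simp: coeff_eq_0)
  also have "\<dots> = (\<Sum>i\<le>n. to_fract (smult (coeff P i) (s_num i n)) / to_fract (denom n))"
    by (intro sum.cong refl) (simp add: s_fun_eq[where n = n] flip: to_fract_mult)
  finally show ?thesis by (simp add: comb_def sum_divide_distrib)
qed

lemma poly_denom_th [simp]: "poly (denom n) (th k) \<noteq> 0"
  using th_neq_eta by (auto simp: denom_def poly_prod)

lemma poly_s_num:
  assumes "i \<le> n" "\<And>k. x \<noteq> eta k"
  shows "poly (s_num i n) x = poly (denom n) x * s_val i x"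
proof -
  have "(\<Prod>k<n. x - eta k) = (\<Prod>k<i. x - eta k) * (\<Prod>k=i..<n. x - eta k)"
    unfolding lessThan_atLeast0 using assms by (simp add: prod.atLeastLessThan_concat)
  moreover have "(\<Prod>k<i. (th k - x) / (\<theta> - \<eta>) ^ (q ^ k)) = (\<Prod>k<i. x - eta k) * s_val i x"
    unfolding s_val_def prod.distrib[symmetric] using assms(2) theta_neq_eta
    by (intro prod.cong refl) (simp add: field_simps)
  moreover have "poly (\<Prod>k<i. smult (1 / (\<theta> - \<eta>) ^ (q ^ k)) [:th k, - 1:]) x =
      (\<Prod>k<i. (th k - x) / (\<theta> - \<eta>) ^ (q ^ k))"
    by (simp add: poly_prod diff_divide_distrib)
  moreover have "poly (\<Prod>k\<in>A. [:- eta k, 1:]) x = (\<Prod>k\<in>A. x - eta k)" for A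
    by (simp add: poly_prod)
  ultimately show ?thesis
    unfolding s_num_def denom_def poly_mult by (simp only: mult_ac)
qed

lemma poly_comb:
  assumes "\<And>k. x \<noteq> eta k"
  shows "poly (comb c n) x = poly (denom n) x * (\<Sum>i\<le>n. c i * s_val i x)"
  unfolding comb_def poly_sum sum_distrib_left
proof (intro sum.cong refl)
  fix i assume "i \<in> {..n}"
  then have "poly (s_num i n) x = poly (denom n) x * s_val i x" using assms by (intro poly_s_num) auto
  then show "poly (smult (c i) (s_num i n)) x = poly (denom n) x * (c i * s_val i x)" by simp
qed

lemma s_val_eq_0: "k < i \<Longrightarrow> s_val i (th k) = 0"
  by (auto simp: s_val_def)

lemma s_val_nonzero: "i \<le> k \<Longrightarrow> s_val i (th k) \<noteq> 0"
  using theta_neq_eta th_neq_eta by (auto simp: s_val_def)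

text \<open>The matrix of values \<open>s_val i (th k)\<close> is triangular with nonzero diagonal,
  so the coefficients are recovered one after another from the values at \<open>th 0\<close>,
  \<open>th 1\<close>, and so on.\<close>

lemma s_val_unique:
  assumes "\<And>k. (\<Sum>i\<le>n. c i * s_val i (th k)) = (\<Sum>i\<le>n. d i * s_val i (th k))" "i \<le> n"
  shows "c i = d i"
  using assms(2)
proof (induction i rule: less_induct)
  case (less i)
  have "(\<Sum>j\<le>n. (c j - d j) * s_val j (th i)) = 0"
    using assms(1)[of i] by (simp add: left_diff_distrib sum_subtractf)
  also have "(\<Sum>j\<le>n. (c j - d j) * s_val j (th i)) = (\<Sum>j\<in>{i}. (c j - d j) * s_val j (th i))"
  proof (rule sum.mono_neutral_right)
    show "\<forall>j\<in>{..n} - {i}. (c j - d j) * s_val j (th i) = 0"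
    proof
      fix j assume "j \<in> {..n} - {i}"
      then show "(c j - d j) * s_val j (th i) = 0"
        using less s_val_eq_0[of i j] by (cases "j < i") auto
    qed
  qed (use less in auto)
  finally show ?case using s_val_nonzero[of i i] by simp
qed

lemma degree_s_num: "degree (s_num i n) \<le> n" if "i \<le> n"
proof -
  have "degree (\<Prod>k<i. smult (1 / (\<theta> - \<eta>) ^ (q ^ k)) [:th k, - 1:]) \<le> (\<Sum>k<i. 1)"
    by (intro order.trans[OF degree_prod_sum_le] sum_mono)
       (auto simp del: smult_pCons intro!: order.trans[OF degree_smult_le])
  moreover have "degree (\<Prod>k=i..<n. [:- eta k, 1:]) \<le> (\<Sum>k=i..<n. 1)"
    by (intro order.trans[OF degree_prod_sum_le] sum_mono) auto
  ultimately have "degree (s_num i n) \<le> i + (n - i)"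
    unfolding s_num_def by (intro order.trans[OF degree_mult_le] add_mono) simp_all
  then show ?thesis using that by simp
qed

text \<open>At \<open>eta n\<close> every numerator with index at most \<open>n\<close> over
  \<open>denom (Suc n)\<close> vanishes, while the top one does not. Hence the top coefficient is
  forced by the value there, and dividing the remainder by \<open>t - eta n\<close> lowers the
  degree.\<close>

lemma comb_surj: "degree G \<le> n \<Longrightarrow> \<exists>c. comb c n = G"
proof (induction n arbitrary: G)
  case 0
  then obtain c where "G = [:c:]" using degree_eq_zeroE by blast
  then show ?case by (intro exI[of _ "\<lambda>_. c"]) (simp add: comb_def s_num_def)
next
  case (Suc n)
  let ?S = "s_num (Suc n) (Suc n)"
  have nz: "poly ?S (eta n) \<noteq> 0"
    using theta_neq_eta th_neq_eta by (auto simp: s_num_def poly_prod)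
  define c0 where "c0 = poly G (eta n) / poly ?S (eta n)"
  define H where "H = G - smult c0 ?S"
  have "poly H (eta n) = 0" using nz by (simp add: H_def c0_def)
  then obtain K where K: "H = [:- eta n, 1:] * K" by (metis dvdE poly_eq_0_iff_dvd)
  have "degree H \<le> Suc n" unfolding H_def
    using Suc.prems degree_s_num[of "Suc n" "Suc n"]
    by (intro degree_diff_le order.trans[OF degree_smult_le]) auto
  then have "degree K \<le> n"
    using K by (cases "K = 0") (simp_all add: degree_mult_eq del: mult_pCons_left)
  then obtain c where c: "comb c n = K" using Suc.IH by blast
  let ?c = "c(Suc n := c0)"
  have "(\<Sum>i\<le>n. smult (?c i) (s_num i (Suc n))) = [:- eta n, 1:] * comb c n"
    unfolding comb_def sum_distrib_left
  proof (rule sum.cong[OF refl])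
    fix i assume "i \<in> {..n}"
    then show "smult (?c i) (s_num i (Suc n)) = [:- eta n, 1:] * smult (c i) (s_num i n)"
      by (auto simp: s_num_def mult_ac simp del: mult_pCons_left mult_pCons_right smult_pCons)
  qed
  then have "comb ?c (Suc n) = H + smult c0 ?S"
    unfolding comb_def[of _ "Suc n"] by (simp add: c K del: mult_pCons_left)
  also have "\<dots> = G" by (simp add: H_def)
  finally have "comb ?c (Suc n) = G" .
  then show ?case by blast
qed

lemma denom_add: "denom (m + n) = denom m * (\<Prod>k<n. [:- eta (k + m), 1:])"
proof (induction n)
  case (Suc n)
  have "denom (m + Suc n) = denom (m + n) * [:- eta (n + m), 1:]"
    by (simp add: denom_def add.commute[of m] del: mult_pCons_left mult_pCons_right)
  also have "\<dots> = denom m * ((\<Prod>k<n. [:- eta (k + m), 1:]) * [:- eta (n + m), 1:])"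
    by (simp only: Suc mult.assoc)
  finally show ?case by (simp only: prod.lessThan_Suc)
qed simp

text \<open>The conjugates repeat with period \<open>N\<close>, so each block of \<open>N\<close>
  linear factors is a copy of \<open>\<rho>\<close>. Elements of the ring, whose denominators are
  powers of \<open>\<rho>\<close>, thereby get a denominator of the form
  \<open>denom n\<close>.\<close>

lemma denom_mult_N: "denom (m * N) = map_poly emb (\<rho> ^ m)"
proof (induction m)
  case (Suc m)
  have "denom (Suc m * N) = denom (m * N) * (\<Prod>k<N. [:- eta (k + m * N), 1:])"
    by (simp only: mult_Suc add.commute[of N] denom_add)
  also have "\<dots> = map_poly emb (\<rho> ^ m) * map_poly emb \<rho>"
    by (simp only: eta_mult_N Suc map_rho)
  finally show ?case by (simp add: map_emb_mult mult.commute)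
qed (simp add: denom_def emb_1)

text \<open>This is the transcendence of \<open>\<theta>\<close> over the constants. Factors
  \<open>\<rho>\<close> are split off until \<open>absv_rho_adic\<close> with exponent 0 gives
  absolute value 1.\<close>

lemma poly_theta_nonzero:
  "g \<noteq> 0 \<Longrightarrow> poly (map_poly emb g) \<theta> \<noteq> 0"
proof (induction "degree g" arbitrary: g rule: less_induct)
  case less
  show ?case
  proof (cases "\<rho> dvd g")
    case False
    then show ?thesis using absv_rho_adic[of g 0] by auto
  next
    case True
    then obtain h where h: "g = \<rho> * h" by blast
    then have "h \<noteq> 0" using less.prems by auto
    moreover have "degree h < degree g"
      using h \<open>h \<noteq> 0\<close> rho_nonzero N_ge_2 by (simp add: degree_mult_eq N_def)
    ultimately have "poly (map_poly emb h) \<theta> \<noteq> 0" using less.hyps by blast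
    moreover have "poly (map_poly emb \<rho>) \<theta> \<noteq> 0"
      using th_neq_eta[of 0] by (auto simp: map_rho poly_prod)
    ultimately show ?thesis by (simp add: h map_emb_mult)
  qed
qed

section \<open>Evaluation at theta and the coefficients of Psi_a\<close>

lemma at_theta_Fract:
  "h \<noteq> 0 \<Longrightarrow> at_theta emb \<theta> (Fract g h) = poly (map_poly emb g) \<theta> / poly (map_poly emb h) \<theta>"
  unfolding at_theta_def
  by (rule fract_lift_Fract) (auto simp: map_emb_mult poly_theta_nonzero)

lemma base_change_Fract:
  "h \<noteq> 0 \<Longrightarrow> base_change emb (Fract g h) = to_fract (map_poly emb g) / to_fract (map_poly emb h)"
  unfolding base_change_def
  by (rule fract_lift_Fract) (auto simp: map_emb_mult)

text \<open>\<open>Psi\<close> is a definite description, so its value must first be shown to exist,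
  by \<open>comb_surj\<close>, and to be unique, by \<open>s_val_unique\<close>. The power of
  \<open>at_theta emb \<theta> a\<close> appears because Frobenius fixes the coefficients of
  \<open>a\<close> and moves only the point.\<close>

lemma Psi_eval:
  assumes "a \<in> ring_away \<rho>"
  shows "(\<Sum>i\<le>degree (Psi emb \<theta> \<eta> a). coeff (Psi emb \<theta> \<eta> a) i * s_val i (th k)) =
           at_theta emb \<theta> a ^ (q ^ k)"
proof -
  let ?R = "\<lambda>P. base_change emb a =
    (\<Sum>i\<le>degree P. to_fract [:coeff P i:] * s_fun CARD('f) \<theta> \<eta> i)"
  obtain g m where a: "a = Fract g (\<rho> ^ m)" and deg: "degree g \<le> m * degree \<rho>"
    using ring_away_imp_Fract[OF irred assms] by blast
  have \<rho>: "\<rho> ^ m \<noteq> 0" using rho_nonzero by simp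
  let ?G = "map_poly emb g" and ?n = "m * N"
  have bc: "base_change emb a = to_fract ?G / to_fract (denom ?n)"
    unfolding a base_change_Fract[OF \<rho>] denom_mult_N ..
  have val: "at_theta emb \<theta> a ^ (q ^ k) = poly ?G (th k) / poly (denom ?n) (th k)" for k
    unfolding a at_theta_Fract[OF \<rho>] denom_mult_N by (simp only: power_divide frob_poly_emb)
  \<comment> \<open>Any candidate has these values: after clearing denominators, both sides are
    polynomials and can be evaluated at \<open>th k\<close>, where no denominator vanishes.\<close>
  have eval: "(\<Sum>i\<le>n. coeff P i * s_val i (th k)) = at_theta emb \<theta> a ^ (q ^ k)"
    if P: "?R P" and n: "degree P \<le> n" for P n k
  proof -
    have "to_fract (comb (coeff P) n) / to_fract (denom n) = to_fract ?G / to_fract (denom ?n)"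
      using P bc sum_s_fun_eq[OF n] by simp
    then have "to_fract (comb (coeff P) n * denom ?n) = to_fract (?G * denom n)"
      by (simp add: frac_eq_eq)
    then have "comb (coeff P) n * denom ?n = ?G * denom n" by (simp only: to_fract_eq_iff)
    then have "poly (comb (coeff P) n) (th k) * poly (denom ?n) (th k)
        = poly ?G (th k) * poly (denom n) (th k)"
      by (metis poly_mult)
    then show ?thesis
      using poly_comb[OF th_neq_eta, of "coeff P" n k] poly_denom_th[of n k] poly_denom_th[of ?n k]
      by (simp add: val eq_divide_eq)
  qed
  obtain c where c: "comb c ?n = ?G"
    using comb_surj[of ?G ?n] deg by (auto simp: N_def)
  define P where "P = (\<Sum>i\<le>?n. monom (c i) i)"
  have coeffP: "coeff P i = (if i \<le> ?n then c i else 0)" for i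
    by (simp add: P_def coeff_sum)
  have degP: "degree P \<le> ?n" by (rule degree_le) (simp add: coeffP)
  have "comb (coeff P) ?n = ?G" unfolding c[symmetric] comb_def by (simp add: coeffP)
  then have P: "?R P" using sum_s_fun_eq[OF degP] bc by simp
  have "Psi emb \<theta> \<eta> a = P" unfolding Psi_def
  proof (rule the_equality)
    show "?R P" by (rule P)
    show "P' = P" if P': "?R P'" for P'
    proof (rule poly_eqI)
      fix i
      \<comment> \<open>One length for both candidates, large enough to include the index
        \<open>i\<close> under comparison.\<close>
      let ?M = "max i (max (degree P) (degree P'))"
      show "coeff P' i = coeff P i"
      proof (rule s_val_unique[where n = ?M])
        show "(\<Sum>i\<le>?M. coeff P' i * s_val i (th k)) = (\<Sum>i\<le>?M. coeff P i * s_val i (th k))" for k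
          using eval[OF P', of ?M] eval[OF P, of ?M] by simp
      qed simp
    qed
  qed
  then show ?thesis using eval[OF P order.refl] by simp
qed

lemma coeff_Psi_0: "a \<in> ring_away \<rho> \<Longrightarrow> coeff (Psi emb \<theta> \<eta> a) 0 = at_theta emb \<theta> a"
proof -
  assume a: "a \<in> ring_away \<rho>"
  let ?P = "Psi emb \<theta> \<eta> a"
  have "(\<Sum>i\<le>degree ?P. coeff ?P i * s_val i (th 0)) = (\<Sum>i\<in>{0}. coeff ?P i * s_val i (th 0))"
    by (intro sum.mono_neutral_right) (auto simp: s_val_eq_0[of 0, simplified])
  then show ?thesis using Psi_eval[OF a, of 0] by (simp add: s_val_def)
qed

section \<open>The numbers D_k and the values of the s_i\<close>

abbreviation D :: "nat \<Rightarrow> 'c" where "D \<equiv> D_coeff q \<theta> \<eta>"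

lemma D_nonzero [simp]: "D k \<noteq> 0"
proof (induction k)
  case (Suc k)
  have "th (Suc k) \<noteq> \<eta>" "\<theta> \<noteq> th (Suc k)"
    using th_neq_eta[of "Suc k" 0] theta_neq_th[of "Suc k"] by simp_all
  then show ?case using Suc by (simp del: power_Suc)
qed simp

text \<open>The recursion for \<open>D (k - i)\<close>, raised to the power \<open>q ^ i\<close>,
  contributes exactly the factor by which \<open>s_val (Suc i) (th k)\<close> differs from
  \<open>s_val i (th k)\<close>. The case \<open>i = k\<close> identifies \<open>D k\<close> with
  the value of s_k at \<open>th k\<close>.\<close>

lemma s_val_th: "i \<le> k \<Longrightarrow> s_val i (th k) = D k / D (k - i) ^ (q ^ i)"
proof (induction i)
  case (Suc i)
  obtain d where d: "k - i = Suc d" using Suc.prems by (metis Suc_diff_Suc Suc_le_lessD)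
  have k: "k = Suc d + i" "k - Suc i = d" using d Suc.prems by simp_all
  have "((\<theta> - th (Suc d)) / ((th (Suc d) - \<eta>) * (\<theta> - \<eta>))) ^ (q ^ i) =
      (th i - th k) / ((th k - eta i) * (\<theta> - \<eta>) ^ (q ^ i))" (is "_ = ?x")
    by (simp only: k(1) power_divide power_mult_distrib frob_diff th_add[of "Suc d"])
  moreover have "(D d ^ q) ^ (q ^ i) = D d ^ (q ^ Suc i)" by (simp add: power_mult)
  ultimately have D: "D (k - i) ^ (q ^ i) = D d ^ (q ^ Suc i) * ?x"
    by (simp only: d D_coeff.simps power_mult_distrib)
  have s: "s_val (Suc i) (th k) = s_val i (th k) * ?x"
    by (simp add: s_val_def mult.commute)
  have s': "s_val i (th k) = D k / (D d ^ (q ^ Suc i) * ?x)"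
    using Suc D by simp
  have cancel: "a / (e * x) * x = a / e" if "x \<noteq> 0" for a e x :: 'c
    using that by simp
  have "D k / (D d ^ (q ^ Suc i) * ?x) * ?x = D k / D d ^ (q ^ Suc i)"
  proof -
    have "th i \<noteq> th k" using Suc.prems by (simp only: th_eq_iff)
    then have "?x \<noteq> 0" by simp
    then show ?thesis by (rule cancel)
  qed
  then show ?case by (simp only: s s' k(2))
qed (simp add: s_val_def)

section \<open>Convergence\<close>


text \<open>The sort of \<open>'c\<close> provides a metric and a field but no norm, so the limit
  laws are derived from real sequences of absolute values.\<close>

lemma tendsto_absv_iff: "(X \<longlongrightarrow> L) F \<longleftrightarrow> ((\<lambda>n. absv (X n - L)) \<longlongrightarrow> 0) F"
  by (subst tendsto_dist_iff) (simp add: dist_absv)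

lemma tendsto_absv_bound:
  assumes "\<forall>\<^sub>F n in F. absv (X n - L) \<le> B n" "(B \<longlongrightarrow> 0) F"
  shows "(X \<longlongrightarrow> L) F"
  unfolding tendsto_absv_iff
  by (rule Lim_null_comparison[OF _ assms(2)]) (use assms(1) in simp)

lemma tendsto_absv_add:
  assumes "(X \<longlongrightarrow> L) F" "(Y \<longlongrightarrow> M) F"
  shows "((\<lambda>n. X n + Y n) \<longlongrightarrow> (L + M :: 'c)) F"
proof (rule tendsto_absv_bound[OF always_eventually])
  have "((\<lambda>n. absv (X n - L) + absv (Y n - M)) \<longlongrightarrow> 0 + 0) F"
    using assms unfolding tendsto_absv_iff by (rule tendsto_add)
  then show "((\<lambda>n. absv (X n - L) + absv (Y n - M)) \<longlongrightarrow> 0) F" by simp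
  show "\<forall>n. absv (X n + Y n - (L + M)) \<le> absv (X n - L) + absv (Y n - M)"
  proof
    fix n
    have "absv ((X n - L) + (Y n - M)) \<le> max (absv (X n - L)) (absv (Y n - M))" by (rule absv_add)
    also have "\<dots> \<le> absv (X n - L) + absv (Y n - M)" by simp
    finally show "absv (X n + Y n - (L + M)) \<le> absv (X n - L) + absv (Y n - M)"
      by (simp add: add_diff_add)
  qed
qed

lemma tendsto_absv_scale:
  assumes "(X \<longlongrightarrow> L) F"
  shows "((\<lambda>n. c * X n) \<longlongrightarrow> (c * L :: 'c)) F"
proof -
  have "((\<lambda>n. absv c * absv (X n - L)) \<longlongrightarrow> absv c * 0) F"
    using assms unfolding tendsto_absv_iff by (rule tendsto_mult_left)
  then show ?thesis unfolding tendsto_absv_iff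
    by (simp flip: absv_mult add: right_diff_distrib)
qed

lemma tendsto_absv_frob:
  assumes "(X \<longlongrightarrow> L) F"
  shows "((\<lambda>n. X n ^ (q ^ i)) \<longlongrightarrow> (L ^ (q ^ i) :: 'c)) F"
proof -
  have "((\<lambda>n. absv (X n - L) ^ (q ^ i)) \<longlongrightarrow> 0 ^ (q ^ i)) F"
    using assms unfolding tendsto_absv_iff by (rule tendsto_power)
  then show ?thesis unfolding tendsto_absv_iff
    by (simp flip: absv_power frob_diff add: power_0_left)
qed

lemma sums_absv_add: "f sums s \<Longrightarrow> g sums t \<Longrightarrow> (\<lambda>n. f n + g n) sums (s + t :: 'c)"
  unfolding sums_def sum.distrib by (rule tendsto_absv_add)

lemma sums_absv_scale: "f sums s \<Longrightarrow> (\<lambda>n. c * f n) sums (c * s :: 'c)"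
  unfolding sums_def sum_distrib_left[symmetric] by (rule tendsto_absv_scale)

lemma sums_absv_frob: "f sums s \<Longrightarrow> (\<lambda>n. f n ^ (q ^ i)) sums (s ^ (q ^ i) :: 'c)"
  unfolding sums_def frob_sum[symmetric] by (rule tendsto_absv_frob)

lemma sums_absv_sum:
  assumes "finite A" "\<And>i. i \<in> A \<Longrightarrow> f i sums s i"
  shows "(\<lambda>n. \<Sum>i\<in>A. f i n) sums (\<Sum>i\<in>A. s i :: 'c)"
  using assms by (induction A rule: finite_induct) (simp_all add: sums_absv_add)

text \<open>Prepending \<open>k\<close> zeros re-indexes a series so that the \<open>q ^ k\<close>
  power of the term in \<open>\<xi> ^ (q ^ (n - k))\<close> is found at index
  \<open>n\<close>.\<close>

lemma sums_absv_shift: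
  fixes f :: "nat \<Rightarrow> 'c"
  assumes "f sums s"
  shows "(\<lambda>n. if k \<le> n then f (n - k) else 0) sums s"
  unfolding sums_def
proof (rule LIMSEQ_offset[of _ k])
  have "(\<Sum>i<n + k. if k \<le> i then f (i - k) else 0) = (\<Sum>i<n. f i)" for n
  proof (induction n)
    case 0
    have "(\<Sum>i<k. if k \<le> i then f (i - k) else 0) = 0" by (rule sum.neutral) auto
    then show ?case by simp
  qed simp
  then show "(\<lambda>n. \<Sum>i<n + k. if k \<le> i then f (i - k) else 0) \<longlonglongrightarrow> s"
    using assms by (simp add: sums_def)
qed

text \<open>In an ultrametric a block of terms is bounded by its largest member, so terms tending to
  0 already make the partial sums Cauchy.\<close>

lemma summable_absv:
  fixes f :: "nat \<Rightarrow> 'c"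
  assumes "(\<lambda>n. absv (f n)) \<longlonglongrightarrow> 0"
  shows "summable f"
proof -
  have "Cauchy (\<lambda>n. \<Sum>i<n. f i)"
  proof (rule metric_CauchyI)
    fix e :: real assume e: "e > 0"
    then obtain M where M: "\<And>n. n \<ge> M \<Longrightarrow> absv (f n) < e / 2"
      using LIMSEQ_D[OF assms, of "e / 2"] by auto
    have close: "absv ((\<Sum>i<n. f i) - (\<Sum>i<m. f i)) < e" if "M \<le> m" "m \<le> n" for m n
    proof -
      have "(\<Sum>i<n. f i) - (\<Sum>i<m. f i) = (\<Sum>i\<in>{m..<n}. f i)"
        using that by (simp add: sum_diff_nat_ivl lessThan_atLeast0)
      moreover have "absv (\<Sum>i\<in>{m..<n}. f i) \<le> e / 2"
        using that e M by (intro absv_sum_le) (auto simp: less_imp_le)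
      ultimately show ?thesis using e by simp
    qed
    show "\<exists>M. \<forall>m\<ge>M. \<forall>n\<ge>M. dist (\<Sum>i<m. f i) (\<Sum>i<n. f i) < e"
    proof (intro exI[of _ M] allI impI)
      fix m n assume "m \<ge> M" "n \<ge> M"
      then show "dist (\<Sum>i<m. f i) (\<Sum>i<n. f i) < e"
        using close[of m n] close[of n m] absv_minus_commute by (cases "m \<le> n") (simp_all add: dist_absv)
    qed
  qed
  then have "convergent (\<lambda>n. \<Sum>i<n. f i)" by (rule Cauchy_convergent)
  then show ?thesis by (simp add: summable_def sums_def convergent_def)
qed

lemma absv_le_of_tendsto:
  assumes "X \<longlonglongrightarrow> s" "\<And>n. absv (X n) \<le> B"
  shows "absv s \<le> B"
proof (rule ccontr)
  assume "\<not> absv s \<le> B"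
  moreover have "B \<ge> 0" using assms(2)[of 0] absv_nonneg order_trans by blast
  ultimately have s: "absv s > B" "absv s > 0" by auto
  then obtain n where "absv (X n - s) < absv s"
    using LIMSEQ_D[OF assms(1)[unfolded tendsto_absv_iff], of "absv s"] by auto
  moreover have "absv (X n - (X n - s)) \<le> max (absv (X n)) (absv (X n - s))" by (rule absv_diff)
  ultimately show False using s assms(2)[of n] by auto
qed

lemma sums_absv_le:
  assumes "f sums s" "\<And>n. absv (f n) \<le> B"
  shows "absv s \<le> B"
proof (rule absv_le_of_tendsto)
  show "(\<lambda>n. \<Sum>i<n. f i) \<longlonglongrightarrow> s" using assms(1) by (simp add: sums_def)
  have "B \<ge> 0" using assms(2)[of 0] absv_nonneg order_trans by blast
  then show "absv (\<Sum>i<n. f i) \<le> B" for n by (intro absv_sum_le assms)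
qed

section \<open>The exponential\<close>

text \<open>If \<open>N\<close> divides \<open>Suc i\<close>, numerator and
  \<open>\<theta> - \<eta>\<close> both have absolute value \<open>1 / q\<close> and cancel, while
  \<open>th (Suc i) - \<eta>\<close> is very small. Otherwise \<open>\<theta> - \<eta>\<close> is
  the only factor whose absolute value is not 1.\<close>

lemma absv_D_factor:
  "absv ((\<theta> - th (Suc i)) / ((th (Suc i) - \<eta>) * (\<theta> - \<eta>))) =
     (if Suc i mod N = 0 then real q ^ (q ^ Suc i) else real q)"
proof -
  have "absv (th (Suc i) - \<eta>) = (if Suc i mod N = 0 then (1 / real q) ^ (q ^ Suc i) else 1)"
    using absv_th_minus_eta[of "Suc i" 0] by simp
  then show ?thesis
    unfolding absv_divide absv_mult absv_pi absv_theta_minus_th[OF zero_less_Suc]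
    by (simp add: power_one_over divide_simps del: power_Suc)
qed

text \<open>The exponent \<open>i div N\<close> increases exactly at multiples of \<open>N\<close>,
  where the new factor supplies \<open>q ^ (q ^ Suc i)\<close>; at the other indices it is enough
  that the factor is at least 1.\<close>

lemma absv_D_ge: "absv (D i) \<ge> real q ^ ((i div N) * q ^ i)"
proof (induction i)
  case (Suc i)
  let ?F = "(\<theta> - th (Suc i)) / ((th (Suc i) - \<eta>) * (\<theta> - \<eta>))"
  have "(real q ^ ((i div N) * q ^ i)) ^ q \<le> absv (D i) ^ q"
    using Suc by (intro power_mono) auto
  moreover have "real q ^ ((i div N) * q ^ Suc i) = (real q ^ ((i div N) * q ^ i)) ^ q"
    by (simp add: mult_ac flip: power_mult)
  ultimately have *: "real q ^ ((i div N) * q ^ Suc i) \<le> absv (D i ^ q)"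
    by (simp add: absv_power)
  have "real q ^ ((Suc i div N) * q ^ Suc i) \<le> real q ^ ((i div N) * q ^ Suc i) * absv ?F"
  proof (cases "Suc i mod N = 0")
    case True
    then have "(Suc i div N) * q ^ Suc i = (i div N) * q ^ Suc i + q ^ Suc i"
      by (simp add: div_Suc)
    then show ?thesis unfolding absv_D_factor using True by (simp only: power_add if_True order.refl simp_thms)
  next
    case False
    then have "Suc i div N = i div N" by (simp add: div_Suc)
    moreover have "1 \<le> q" using q_ge_2 by simp
    ultimately show ?thesis unfolding absv_D_factor using False by (simp del: power_Suc)
  qed
  also have "\<dots> \<le> absv (D i ^ q) * absv ?F"
    using * by (intro mult_right_mono) auto
  finally show ?case by (simp only: D_coeff.simps absv_mult)
qed simp

lemma absv_D_ge_1: "absv (D i) \<ge> 1"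
proof -
  have "1 \<le> real q ^ ((i div N) * q ^ i)" using q_ge_2 by (intro one_le_power) auto
  then show ?thesis using absv_D_ge[of i] by linarith
qed

lemma le_q_power: "i \<le> q ^ i"
  using q_ge_2 by (metis less_exp less_imp_le order.trans power_mono zero_le_numeral)

lemma exp_terms_tendsto_0: "(\<lambda>i. absv (\<xi> ^ (q ^ i) / D i)) \<longlonglongrightarrow> 0"
proof (rule Lim_null_comparison)
  \<comment> \<open>From index \<open>M * N\<close> on, \<open>absv (D i)\<close> is at least
    \<open>(2 * absv \<xi>) ^ (q ^ i)\<close>, which leaves at most
    \<open>(1 / 2) ^ (q ^ i)\<close>.\<close>
  obtain M where M: "2 * absv \<xi> < real q ^ M"
    using real_arch_pow[of "real q" "2 * absv \<xi>"] q_ge_2 by auto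
  show "\<forall>\<^sub>F i in sequentially. norm (absv (\<xi> ^ (q ^ i) / D i)) \<le> (1 / 2) ^ i"
    unfolding eventually_sequentially
  proof (intro exI allI impI)
    fix i assume i: "i \<ge> M * N"
    let ?m = "i div N"
    have "M * N div N \<le> ?m" using i by (rule div_le_mono)
    then have "M \<le> ?m" using N_ge_2 by simp
    then have "real q ^ M \<le> real q ^ ?m" using q_ge_2 by (intro power_increasing) auto
    then have "absv \<xi> \<le> 1 / 2 * real q ^ ?m" using M by simp
    then have "absv \<xi> ^ (q ^ i) \<le> (1 / 2 * real q ^ ?m) ^ (q ^ i)" by (intro power_mono) auto
    also have "\<dots> = (1 / 2) ^ (q ^ i) * real q ^ (?m * q ^ i)"
      by (simp only: power_mult_distrib power_mult)
    also have "\<dots> \<le> (1 / 2) ^ (q ^ i) * absv (D i)"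
      using absv_D_ge[of i] by (intro mult_left_mono) auto
    finally have "absv \<xi> ^ (q ^ i) / absv (D i) \<le> (1 / 2) ^ (q ^ i)"
      using absv_D_ge_1[of i] by (simp add: divide_le_eq)
    also have "\<dots> \<le> (1 / 2) ^ i" using le_q_power by (intro power_decreasing) auto
    finally show "norm (absv (\<xi> ^ (q ^ i) / D i)) \<le> (1 / 2) ^ i" by (simp add: absv_divide absv_power)
  qed
  show "(\<lambda>i. (1 / 2 :: real) ^ i) \<longlonglongrightarrow> 0" by (rule LIMSEQ_realpow_zero) auto
qed

definition expo :: "'c \<Rightarrow> 'c" where "expo \<xi> = (\<Sum>i. \<xi> ^ (q ^ i) / D i)"

lemma expo_sums: "(\<lambda>i. \<xi> ^ (q ^ i) / D i) sums expo \<xi>"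
  unfolding expo_def by (intro summable_sums summable_absv exp_terms_tendsto_0)

lemma expo_add: "expo (x + y) = expo x + expo y"
proof (rule sums_unique2[OF expo_sums])
  show "(\<lambda>i. (x + y) ^ (q ^ i) / D i) sums (expo x + expo y)"
    using sums_absv_add[OF expo_sums[of x] expo_sums[of y]] by (simp add: frob_add add_divide_distrib)
qed

lemma Fq_linear_expo: "Fq_linear emb expo"
  unfolding Fq_linear_def
proof (intro conjI allI expo_add)
  fix a x
  show "expo (emb a * x) = emb a * expo x"
  proof (rule sums_unique2[OF expo_sums])
    show "(\<lambda>i. (emb a * x) ^ (q ^ i) / D i) sums (emb a * expo x)"
      using sums_absv_scale[OF expo_sums[of x], of "emb a"] by (simp add: power_mult_distrib emb_power_q)
  qed
qed

lemma expo_functional_equation: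
  assumes a: "a \<in> ring_away \<rho>"
  shows "tau_eval CARD('f) (Psi emb \<theta> \<eta> a) (expo \<xi>) = expo (at_theta emb \<theta> a * \<xi>)"
proof -
  let ?P = "Psi emb \<theta> \<eta> a" and ?A = "at_theta emb \<theta> a"
  let ?t = "\<lambda>i n. coeff ?P i * (if i \<le> n then (\<xi> ^ (q ^ (n - i)) / D (n - i)) ^ (q ^ i) else 0)"
  have "(\<lambda>n. \<Sum>i\<le>degree ?P. ?t i n) sums (\<Sum>i\<le>degree ?P. coeff ?P i * expo \<xi> ^ (q ^ i))"
    by (intro sums_absv_sum sums_absv_scale sums_absv_shift sums_absv_frob expo_sums) simp
  moreover have "(\<Sum>i\<le>degree ?P. ?t i n) = (?A * \<xi>) ^ (q ^ n) / D n" for n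
  proof -
    \<comment> \<open>For \<open>i > n\<close> the padding zero matches the zero of s_i at
      \<open>th n\<close>; for \<open>i \<le> n\<close> the quotient of the D's comes from
      \<open>s_val_th\<close>.\<close>
    have "?t i n = coeff ?P i * s_val i (th n) * (\<xi> ^ (q ^ n) / D n)" for i
    proof (cases "i \<le> n")
      case True
      then have "(\<xi> ^ (q ^ (n - i))) ^ (q ^ i) = \<xi> ^ (q ^ n)"
        by (simp flip: power_mult power_add)
      then show ?thesis using True by (simp add: s_val_th power_divide)
    qed (simp add: s_val_eq_0)
    then have "(\<Sum>i\<le>degree ?P. ?t i n) =
        (\<Sum>i\<le>degree ?P. coeff ?P i * s_val i (th n)) * (\<xi> ^ (q ^ n) / D n)"
      by (simp only: sum_distrib_right)
    then show ?thesis by (simp only: Psi_eval[OF a] power_mult_distrib) simp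
  qed
  ultimately have "(\<lambda>n. (?A * \<xi>) ^ (q ^ n) / D n) sums tau_eval q ?P (expo \<xi>)"
    by (simp add: tau_eval_def)
  then show ?thesis using sums_unique2[OF _ expo_sums] by (simp add: q_def)
qed

lemma expo_0 [simp]: "expo 0 = 0"
  using expo_add[of 0 0] by (metis add.right_neutral add_left_cancel)

text \<open>Beyond the first term all exponents are at least \<open>q \<ge> 2\<close> and all
  \<open>absv (D i)\<close> are at least 1, so each remaining term is bounded by
  \<open>absv h ^ 2\<close>.\<close>

lemma absv_expo_minus_self:
  assumes "absv h \<le> 1"
  shows "absv (expo h - h) \<le> absv h ^ 2"
proof -
  have "(\<lambda>i. h ^ (q ^ i) / D i + (if i = 0 then - h else 0)) sums (expo h + - h)"
    by (intro sums_absv_add expo_sums sums_single)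
  then have "absv (expo h + - h) \<le> absv h ^ 2"
  proof (rule sums_absv_le)
    fix i
    show "absv (h ^ (q ^ i) / D i + (if i = 0 then - h else 0)) \<le> absv h ^ 2"
    proof (cases i)
      case (Suc j)
      have "2 \<le> q ^ 1" using q_ge_2 by simp
      also have "\<dots> \<le> q ^ i" using q_ge_2 Suc by (intro power_increasing) auto
      finally have "absv h ^ (q ^ i) \<le> absv h ^ 2" using assms by (intro power_decreasing) auto
      moreover have "absv h ^ (q ^ i) / absv (D i) \<le> absv h ^ (q ^ i) / 1"
        using absv_D_ge_1[of i] by (intro divide_left_mono) auto
      ultimately have "absv (h ^ (q ^ i) / D i) \<le> absv h ^ 2" by (simp add: absv_divide absv_power)
      then show ?thesis using Suc by (simp del: power_Suc D_coeff.simps)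
    qed simp
  qed
  then show ?thesis by simp
qed

lemma expo_derivative: "((\<lambda>h. (expo h - expo 0) / h) \<longlongrightarrow> 1) (at 0)"
proof (rule tendsto_absv_bound)
  show "\<forall>\<^sub>F h in at 0. absv ((expo h - expo 0) / h - 1) \<le> dist h 0"
    unfolding eventually_at
  proof (intro exI[of _ 1] conjI ballI impI)
    fix h :: 'c assume h: "h \<noteq> 0 \<and> dist h 0 < 1"
    then have "absv (expo h - h) \<le> absv h ^ 2"
      by (intro absv_expo_minus_self) (simp add: dist_absv)
    moreover have "(expo h - expo 0) / h - 1 = (expo h - h) / h" using h by (simp add: diff_divide_distrib)
    ultimately show "absv ((expo h - expo 0) / h - 1) \<le> dist h 0"
      using h by (simp add: absv_divide dist_absv divide_le_eq power2_eq_square)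
  qed simp
  show "((\<lambda>h::'c. dist h 0) \<longlongrightarrow> 0) (at 0)"
    using tendsto_dist[OF tendsto_ident_at[of 0 UNIV] tendsto_const[of 0]] by simp
qed

lemma is_exponential_expo: "is_exponential emb \<rho> \<theta> \<eta> expo"
  unfolding is_exponential_def
  using Fq_linear_expo expo_derivative expo_functional_equation by blast

section \<open>Uniqueness of the exponential\<close>

lemma tau_eval_diff: "tau_eval q P (x - y) = tau_eval q P x - tau_eval q P (y :: 'c)"
  by (simp add: tau_eval_def frob_diff right_diff_distrib sum_subtractf)

lemma tau_eval_0: "tau_eval q P 0 = (0 :: 'c)"
  by (simp add: tau_eval_def power_0_left)

text \<open>
  For \<open>a = 1 / \<rho>\<close> we have \<open>\<bar>a(\<theta>)\<bar> = q > 1\<close>. The difference \<open>d\<close> of two exponentials satisfies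
  \<open>\<bar>d(h)\<bar> \<le> q \<bar>d(h / a(\<theta>))\<bar>\<close> for small \<open>h\<close>, and \<open>d(h) / h\<close> tends to \<open>0\<close>; iterating gives \<open>d = 0\<close>.
\<close>

lemma exponential_unique:
  assumes "is_exponential emb \<rho> \<theta> \<eta> e" "is_exponential emb \<rho> \<theta> \<eta> e'"
  shows "e = e'"
proof -
  define d where "d x = e x - e' x" for x
  define a where "a = Fract 1 \<rho>"
  define A where "A = at_theta emb \<theta> a"
  define P where "P = Psi emb \<theta> \<eta> a"
  have a: "a \<in> ring_away \<rho>" unfolding a_def by (rule inverse_in_ring_away[OF rho_nonzero])
  have "\<not> \<rho> dvd 1" using irred by (simp add: irreducible_def)
  then have "absv (poly (map_poly emb \<rho>) \<theta>) = 1 / real q"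
    using absv_rho_adic[of 1 1] by (simp add: q_def)
  then have absv_A: "absv A = real q"
    unfolding A_def a_def at_theta_Fract[OF rho_nonzero] by (simp add: absv_divide emb_1)
  then have A: "A \<noteq> 0" by auto
  have e0: "e 0 = 0" "e' 0 = 0"
    using assms unfolding is_exponential_def Fq_linear_def
    by (metis add.right_neutral add_left_cancel)+
  have d_step: "d x = tau_eval q P (d (x / A))" for x
  proof -
    have "tau_eval q P (e (x / A)) = e (A * (x / A))" "tau_eval q P (e' (x / A)) = e' (A * (x / A))"
      using assms a unfolding is_exponential_def P_def A_def q_def by blast+
    then show ?thesis using A by (simp add: d_def tau_eval_diff)
  qed
  \<comment> \<open>For \<open>absv z \<le> 1 / C\<close> the terms of degree at least 2 are at most
    \<open>C * absv z ^ 2 \<le> absv z\<close>, so the linear term, of size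
    \<open>q * absv z\<close>, gives the bound.\<close>
  define C where "C = Max (insert 1 ((\<lambda>i. absv (coeff P i)) ` {..degree P}))"
  have C: "C \<ge> 1" "i \<le> degree P \<Longrightarrow> absv (coeff P i) \<le> C" for i
    unfolding C_def by (rule Max_ge; simp)+
  have P0: "coeff P 0 = A" unfolding P_def A_def by (rule coeff_Psi_0[OF a])
  have small: "absv (tau_eval q P z) \<le> real q * absv z" if z: "absv z \<le> 1 / C" for z
    unfolding tau_eval_def
  proof (rule absv_sum_le)
    fix i assume i: "i \<in> {..degree P}"
    show "absv (coeff P i * z ^ (q ^ i)) \<le> real q * absv z"
    proof (cases i)
      case 0
      then show ?thesis by (simp add: absv_mult P0 absv_A)
    next
      case (Suc j)
      have "2 \<le> q ^ 1" using q_ge_2 by simp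
      also have "\<dots> \<le> q ^ i" using q_ge_2 Suc by (intro power_increasing) auto
      finally have "2 \<le> q ^ i" .
      moreover have "absv z \<le> 1" using z C(1) by (meson divide_le_eq_1_pos less_le_trans order.trans zero_less_one)
      ultimately have "absv z ^ (q ^ i) \<le> absv z ^ 2" by (intro power_decreasing) auto
      then have "absv (coeff P i) * absv z ^ (q ^ i) \<le> C * absv z ^ 2"
        using C i by (intro mult_mono) auto
      also have "\<dots> = (C * absv z) * absv z" by (simp add: power2_eq_square)
      also have "\<dots> \<le> 1 * absv z" using z C(1) by (intro mult_right_mono) (auto simp: field_simps)
      also have "\<dots> \<le> real q * absv z" using q_ge_2 by (intro mult_right_mono) auto
      finally show ?thesis by (simp add: absv_mult absv_power)
    qed
  qed simp
  have "((\<lambda>h. (e h - e 0) / h + (- 1) * ((e' h - e' 0) / h)) \<longlongrightarrow> 1 + (- 1) * 1) (at 0)"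
    using assms unfolding is_exponential_def by (intro tendsto_absv_add tendsto_absv_scale) auto
  then have "((\<lambda>h. d h / h) \<longlongrightarrow> 0) (at 0)"
    by (simp add: e0 d_def diff_divide_distrib)
  then have lim: "((\<lambda>h. absv (d h / h)) \<longlongrightarrow> 0) (at 0)"
    unfolding tendsto_absv_iff by simp
  have bound: "\<exists>\<delta>>0. \<forall>h. absv h < \<delta> \<longrightarrow> absv (d h) \<le> \<epsilon> * absv h" if "\<epsilon> > 0" for \<epsilon>
  proof -
    have "\<forall>\<^sub>F h in at 0. absv (d h / h) < \<epsilon>" using lim that by (rule order_tendstoD)
    then obtain \<delta> where \<delta>: "\<delta> > 0" "\<And>h. h \<noteq> 0 \<Longrightarrow> dist h 0 < \<delta> \<Longrightarrow> absv (d h / h) < \<epsilon>"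
      unfolding eventually_at by auto
    have "absv (d h) \<le> \<epsilon> * absv h" if "absv h < \<delta>" for h
    proof (cases "h = 0")
      case False
      then have "absv (d h / h) < \<epsilon>" using \<delta>(2)[of h] that by (simp add: dist_absv)
      then show ?thesis using False by (simp add: absv_divide divide_less_eq)
    qed (simp add: d_def e0)
    then show ?thesis using \<delta>(1) by blast
  qed
  obtain \<delta>\<^sub>1 where \<delta>\<^sub>1: "\<delta>\<^sub>1 > 0" "\<And>h. absv h < \<delta>\<^sub>1 \<Longrightarrow> absv (d h) \<le> 1 * absv h"
    using bound[of 1] by auto
  \<comment> \<open>Within \<open>\<delta>\<^sub>1\<close> the map \<open>d\<close> does not
    increase absolute values; the second bound then keeps all \<open>d (h / A ^ k)\<close> with
    \<open>k > 0\<close> in the range where \<open>small\<close> applies.\<close>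
  define \<delta> where "\<delta> = min \<delta>\<^sub>1 (1 / C)"
  have \<delta>: "\<delta> > 0" using \<delta>\<^sub>1 C by (simp add: \<delta>_def)
  have absv_div: "absv (h / A ^ k) = absv h / real q ^ k" for h k
    by (simp add: absv_divide absv_power absv_A)
  have le_div: "absv (h / A ^ k) \<le> absv h" for h k
  proof -
    have "absv h / real q ^ k \<le> absv h / 1"
      using q_ge_2 by (intro divide_left_mono) (auto intro!: one_le_power)
    then show ?thesis by (simp add: absv_div)
  qed
  have iter: "absv (d h) \<le> real q ^ k * absv (d (h / A ^ k))" if "absv h < \<delta>" for h k
  proof (induction k)
    case (Suc k)
    have "absv (h / A ^ Suc k) < \<delta>" using le_div[of h "Suc k"] that by linarith
    then have "absv (d (h / A ^ Suc k)) \<le> 1 / C"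
      using \<delta>\<^sub>1(2)[of "h / A ^ Suc k"] by (simp add: \<delta>_def)
    then have "absv (tau_eval q P (d (h / A ^ Suc k))) \<le> real q * absv (d (h / A ^ Suc k))"
      by (rule small)
    moreover have "d (h / A ^ k) = tau_eval q P (d (h / A ^ Suc k))"
      using d_step[of "h / A ^ k"] by (simp add: mult.commute)
    ultimately have "absv (d (h / A ^ k)) \<le> real q * absv (d (h / A ^ Suc k))"
      by (simp only:)
    then have "real q ^ k * absv (d (h / A ^ k)) \<le> real q ^ k * (real q * absv (d (h / A ^ Suc k)))"
      by (intro mult_left_mono) auto
    from order.trans[OF Suc.IH this] show ?case by (simp only: power_Suc mult_ac)
  qed simp
  have tends: "(\<lambda>k. absv h / real q ^ k) \<longlonglongrightarrow> 0" for h
    using q_ge_2 by (intro LIMSEQ_divide_realpow_zero) auto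
  have zero_small: "d h = 0" if h: "absv h < \<delta>" for h
  proof -
    \<comment> \<open>The factor \<open>q ^ k\<close> gained by iterating is exactly compensated by
      the shrinking of \<open>h / A ^ k\<close>, so any \<open>\<epsilon>\<close> valid near 0 is
      valid at \<open>h\<close>.\<close>
    have "absv (d h) \<le> \<epsilon> * absv h" if \<epsilon>: "\<epsilon> > 0" for \<epsilon>
    proof -
      obtain \<delta>' where \<delta>': "\<delta>' > 0" "\<And>h. absv h < \<delta>' \<Longrightarrow> absv (d h) \<le> \<epsilon> * absv h"
        using bound[OF \<epsilon>] by auto
      obtain k where "absv h / real q ^ k < \<delta>'"
        using LIMSEQ_D[OF tends, of \<delta>' h] \<delta>' by auto
      then have "absv (d (h / A ^ k)) \<le> \<epsilon> * (absv h / real q ^ k)"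
        using \<delta>'(2)[of "h / A ^ k"] by (simp add: absv_div)
      then have "real q ^ k * absv (d (h / A ^ k)) \<le> real q ^ k * (\<epsilon> * (absv h / real q ^ k))"
        by (intro mult_left_mono) auto
      also have "\<dots> = \<epsilon> * absv h" by simp
      finally show ?thesis using iter[OF h, of k] by linarith
    qed
    note le = this
    show ?thesis
    proof (rule ccontr)
      assume "d h \<noteq> 0"
      then have pos: "absv (d h) > 0" by simp
      \<comment> \<open>This choice of \<open>\<epsilon>\<close> makes the bound strictly smaller
        than \<open>absv (d h)\<close>; the summand 2 keeps the denominator positive when
        \<open>h = 0\<close>.\<close>
      have "absv (d h) \<le> absv (d h) / (2 * absv h + 2) * absv h"
        using pos by (intro le divide_pos_pos) (auto intro: add_nonneg_pos)
      also have "\<dots> = absv (d h) * (absv h / (2 * absv h + 2))" by simp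
      also have "\<dots> < absv (d h) * 1"
      proof (rule mult_strict_left_mono[OF _ pos])
        have "0 < 2 * absv h + 2" "absv h < 2 * absv h + 2" using absv_nonneg[of h] by linarith+
        then show "absv h / (2 * absv h + 2) < 1" by (simp only: divide_less_eq_1_pos)
      qed
      finally show False by simp
    qed
  qed
  have "d x = 0" for x
  proof -
    \<comment> \<open>Division by a power of \<open>A\<close> moves any \<open>x\<close> into the
      small disc, and \<open>d_step\<close> carries the vanishing back to \<open>x\<close>.\<close>
    obtain k where "absv x / real q ^ k < \<delta>"
      using LIMSEQ_D[OF tends, of \<delta> x] \<delta> by auto
    then have "d (x / A ^ k) = 0" by (intro zero_small) (simp add: absv_div)
    then show ?thesis
    proof (induction k)
      case (Suc k)
      have "d (x / A ^ k) = tau_eval q P (d (x / A ^ Suc k))"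
        using d_step[of "x / A ^ k"] by (simp add: mult.commute)
      then have "d (x / A ^ k) = 0" by (simp only: Suc.prems tau_eval_0)
      then show ?case by (rule Suc.IH)
    qed simp
  qed
  then show ?thesis by (auto simp: d_def)
qed

lemma exp0_eq: "exp0 emb \<rho> \<theta> \<eta> = expo"
  unfolding exp0_def
  by (rule the_equality[where P = "is_exponential emb \<rho> \<theta> \<eta>", OF is_exponential_expo])
     (rule exponential_unique[OF _ is_exponential_expo])

section \<open>Additive power series\<close>


text \<open>Frobenius is additive on finite sums only, so \<open>F\<close> is cut off after index
  \<open>n\<close>; the tail then contributes multiples of \<open>X ^ (Suc n * q ^ i)\<close>,
  beyond index \<open>n\<close>.\<close>

lemma fps_nth_power_frob:
  "fps_nth (F ^ (q ^ i)) n = (if q ^ i dvd n then fps_nth F (n div q ^ i) ^ (q ^ i) else 0 :: 'c)"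
proof -
  let ?Q = "q ^ i"
  have Q: "?Q > 0" by simp
  have sum_frob: "(\<Sum>k\<in>A. g k) ^ ?Q = (\<Sum>k\<in>A. g k ^ ?Q)" for g :: "nat \<Rightarrow> 'c fps" and A
    by (induction A rule: infinite_finite_induct) (simp_all add: frob_fps_add power_0_left)
  define R where "R = fps_shift (Suc n) F"
  have cut: "fps_cutoff (Suc n) F = (\<Sum>k\<le>n. fps_const (fps_nth F k) * fps_X ^ k)"
    by (rule fps_ext) (auto simp: fps_sum_nth fps_X_power_nth if_distrib cong: if_cong)
  have "F ^ ?Q = (R * fps_X ^ Suc n + fps_cutoff (Suc n) F) ^ ?Q"
    unfolding R_def by (simp only: fps_shift_cutoff)
  also have "\<dots> = R ^ ?Q * fps_X ^ (Suc n * ?Q)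
      + (\<Sum>k\<le>n. fps_const (fps_nth F k ^ ?Q) * fps_X ^ (k * ?Q))"
    by (simp only: frob_fps_add cut sum_frob power_mult_distrib power_mult[symmetric] fps_const_power)
  finally have "fps_nth (F ^ ?Q) n = fps_nth (R ^ ?Q * fps_X ^ (Suc n * ?Q)) n
      + (\<Sum>k\<le>n. fps_nth (fps_const (fps_nth F k ^ ?Q) * fps_X ^ (k * ?Q)) n)"
    by (simp only: fps_add_nth fps_sum_nth)
  also have "n < Suc n * ?Q" using Q by (metis lessI less_le_trans mult.right_neutral mult_le_mono2 Suc_leI One_nat_def)
  then have "fps_nth (R ^ ?Q * fps_X ^ (Suc n * ?Q)) n = 0"
    by (simp only: fps_X_power_mult_right_nth if_True)
  also have "(\<Sum>k\<le>n. fps_nth (fps_const (fps_nth F k ^ ?Q) * fps_X ^ (k * ?Q)) n)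
      = (\<Sum>k\<le>n. if n = k * ?Q then fps_nth F k ^ ?Q else 0)"
    by (intro sum.cong refl) (simp add: fps_X_power_nth)
  also have "\<dots> = (if ?Q dvd n then fps_nth F (n div ?Q) ^ ?Q else 0)"
  proof (cases "?Q dvd n")
    case True
    then have "n = k * ?Q \<longleftrightarrow> k = n div ?Q" for k using Q by auto
    then have "(\<Sum>k\<le>n. if n = k * ?Q then fps_nth F k ^ ?Q else 0)
        = (\<Sum>k\<le>n. if k = n div ?Q then fps_nth F k ^ ?Q else 0)" by simp
    also have "\<dots> = fps_nth F (n div ?Q) ^ ?Q" by (simp add: sum.delta)
    finally show ?thesis using True by simp
  next
    case False
    then have "n \<noteq> k * ?Q" for k by auto
    then show ?thesis using False by simp
  qed
  finally show ?thesis by simp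
qed

lemma strict_mono_q_power: "strict_mono (\<lambda>i. q ^ i)"
  using q_ge_2 by (intro strict_monoI power_strict_increasing) auto

lemma q_power_eq_iff: "q ^ i = q ^ j \<longleftrightarrow> i = j"
  using strict_mono_q_power by (simp add: strict_mono_eq)

text \<open>The series with terms \<open>a i * X ^ (q ^ i)\<close>. At most one \<open>i\<close>
  contributes to a coefficient, and \<open>i \<le> q ^ i\<close> ensures that the range
  \<open>i \<le> n\<close> contains it.\<close>

definition additive_fps :: "(nat \<Rightarrow> 'c) \<Rightarrow> 'c fps" where
  "additive_fps a = Abs_fps (\<lambda>n. \<Sum>i\<le>n. if n = q ^ i then a i else 0)"

lemma additive_fps_nth_q_power [simp]: "fps_nth (additive_fps a) (q ^ i) = a i"
  using le_q_power[of i] by (simp add: additive_fps_def q_power_eq_iff)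

lemma additive_fps_nth_eq_0: "n \<notin> range (\<lambda>i. q ^ i) \<Longrightarrow> fps_nth (additive_fps a) n = 0"
  by (auto simp: additive_fps_def intro!: sum.neutral)

lemma additive_fps_eqI:
  assumes "\<And>i. fps_nth F (q ^ i) = a i" "\<And>n. n \<notin> range (\<lambda>i. q ^ i) \<Longrightarrow> fps_nth F n = 0"
  shows "F = additive_fps a"
proof (rule fps_ext)
  fix n
  show "fps_nth F n = fps_nth (additive_fps a) n"
    by (cases "n \<in> range (\<lambda>i. q ^ i)") (auto simp: assms additive_fps_nth_eq_0)
qed

lemma additive_fps_sums:
  "(\<lambda>n. fps_nth (additive_fps a) n * \<xi> ^ n) sums s \<longleftrightarrow> (\<lambda>i. a i * \<xi> ^ (q ^ i)) sums s"
  using sums_mono_reindex[OF strict_mono_q_power, of "\<lambda>n. fps_nth (additive_fps a) n * \<xi> ^ n" s]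
  by (simp add: additive_fps_nth_eq_0)

text \<open>Composition of additive series is multiplication of twisted power series in tau. Only
  powers of the inner series with exponent \<open>q ^ i\<close> enter, and Frobenius computes
  them.\<close>

lemma additive_fps_compose:
  "additive_fps a oo additive_fps b = additive_fps (\<lambda>n. \<Sum>i\<le>n. a i * b (n - i) ^ (q ^ i))"
proof (rule additive_fps_eqI)
  let ?A = "additive_fps a" and ?B = "additive_fps b"
  fix m
  have "fps_nth (?A oo ?B) (q ^ m) = (\<Sum>j\<in>{0..q ^ m}. fps_nth ?A j * fps_nth (?B ^ j) (q ^ m))"
    by (rule fps_compose_nth)
  also have "\<dots> = (\<Sum>j\<in>(\<lambda>i. q ^ i) ` {..m}. fps_nth ?A j * fps_nth (?B ^ j) (q ^ m))"
  proof (rule sum.mono_neutral_right)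
    show "(\<lambda>i. q ^ i) ` {..m} \<subseteq> {0..q ^ m}"
      using strict_mono_less_eq[OF strict_mono_q_power] by auto
    show "\<forall>j\<in>{0..q ^ m} - (\<lambda>i. q ^ i) ` {..m}. fps_nth ?A j * fps_nth (?B ^ j) (q ^ m) = 0"
    proof
      fix j assume j: "j \<in> {0..q ^ m} - (\<lambda>i. q ^ i) ` {..m}"
      have "j \<notin> range (\<lambda>i. q ^ i)"
        using j strict_mono_less_eq[OF strict_mono_q_power] by auto
      then show "fps_nth ?A j * fps_nth (?B ^ j) (q ^ m) = 0" by (simp add: additive_fps_nth_eq_0)
    qed
  qed simp
  also have "\<dots> = (\<Sum>i\<le>m. fps_nth ?A (q ^ i) * fps_nth (?B ^ (q ^ i)) (q ^ m))"
    by (rule sum.reindex_cong[of "\<lambda>i. q ^ i"]) (auto simp: inj_on_def q_power_eq_iff)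
  also have "\<dots> = (\<Sum>i\<le>m. a i * b (m - i) ^ (q ^ i))"
  proof (intro sum.cong refl)
    fix i assume i: "i \<in> {..m}"
    then have "q ^ m = q ^ (m - i) * q ^ i" by (simp flip: power_add)
    then have "q ^ i dvd q ^ m" "q ^ m div q ^ i = q ^ (m - i)" by simp_all
    then show "fps_nth ?A (q ^ i) * fps_nth (?B ^ (q ^ i)) (q ^ m) = a i * b (m - i) ^ (q ^ i)"
      by (simp only: fps_nth_power_frob additive_fps_nth_q_power if_True)
  qed
  finally show "fps_nth (?A oo ?B) (q ^ m) = (\<Sum>i\<le>m. a i * b (m - i) ^ (q ^ i))" .
next
  let ?A = "additive_fps a" and ?B = "additive_fps b"
  fix n assume n: "n \<notin> range (\<lambda>i. q ^ i)"
  show "fps_nth (?A oo ?B) n = 0" unfolding fps_compose_nth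
  proof (rule sum.neutral, rule ballI)
    fix j assume "j \<in> {0..n}"
    show "fps_nth ?A j * fps_nth (?B ^ j) n = 0"
    proof (cases "j \<in> range (\<lambda>i. q ^ i)")
      case True
      then obtain i where i: "j = q ^ i" by blast
      have "fps_nth (?B ^ (q ^ i)) n = 0"
      proof (cases "q ^ i dvd n")
        case True
        then have "n = (n div q ^ i) * q ^ i" by simp
        have "n div q ^ i \<noteq> q ^ k" for k
        proof
          assume "n div q ^ i = q ^ k"
          then have "n = q ^ (k + i)" using \<open>n = _\<close> by (simp add: power_add)
          then show False using n by blast
        qed
        then have "n div q ^ i \<notin> range (\<lambda>i. q ^ i)" by blast
        then show ?thesis
          by (simp add: fps_nth_power_frob additive_fps_nth_eq_0 power_0_left)
      qed (simp add: fps_nth_power_frob)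
      then show ?thesis by (simp add: i)
    qed (simp add: additive_fps_nth_eq_0)
  qed
qed

lemma additive_fps_X: "additive_fps (\<lambda>n. if n = 0 then 1 else 0) = fps_X"
proof (rule sym, rule additive_fps_eqI)
  show "fps_nth fps_X (q ^ i) = (if i = 0 then 1 else 0 :: 'c)" for i
    using q_power_eq_iff[of i 0] by simp
  show "fps_nth (fps_X :: 'c fps) n = 0" if "n \<notin> range (\<lambda>i. q ^ i)" for n
    using that by (auto simp: image_iff) (metis power_0 One_nat_def)
qed

text \<open>Convergence at 1 bounds all coefficients by some \<open>B\<close>. At
  \<open>\<xi> = (\<theta> - \<eta>) ^ k\<close> the lowest nonzero term must be cancelled by higher
  ones, which forces its coefficient below \<open>B * (1 / q) ^ k\<close> for every
  \<open>k\<close>. This makes the description in \<open>exp0_series\<close> unique.\<close>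

lemma fps_eq_0_of_sums_0:
  fixes H :: "'c fps"
  assumes "\<And>\<xi>. (\<lambda>n. fps_nth H n * \<xi> ^ n) sums 0"
  shows "H = 0"
proof (rule ccontr)
  assume "H \<noteq> 0"
  define n where "n = subdegree H"
  have Hn: "fps_nth H n \<noteq> 0" using \<open>H \<noteq> 0\<close> by (simp add: n_def)
  have lt: "fps_nth H m = 0" if "m < n" for m
    using that unfolding n_def by (rule nth_less_subdegree_zero)
  have "(\<lambda>n. \<Sum>k<n. fps_nth H k) \<longlonglongrightarrow> 0"
    using assms[of 1] by (simp add: sums_def)
  then have "bounded (range (\<lambda>n. \<Sum>k<n. fps_nth H k))" by (rule convergent_imp_bounded)
  then obtain B where B: "\<And>n. absv (\<Sum>k<n. fps_nth H k) \<le> B"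
    unfolding bounded_any_center[of _ 0] using dist_absv[of 0] by auto
  have HB: "absv (fps_nth H m) \<le> B" for m
  proof -
    have "absv (fps_nth H m) = absv ((\<Sum>k<Suc m. fps_nth H k) - (\<Sum>k<m. fps_nth H k))" by simp
    also have "\<dots> \<le> max (absv (\<Sum>k<Suc m. fps_nth H k)) (absv (\<Sum>k<m. fps_nth H k))"
      by (rule absv_diff)
    also have "\<dots> \<le> B" by (intro max.boundedI B)
    finally show ?thesis .
  qed
  have small: "absv (fps_nth H n) \<le> B * (1 / real q) ^ k" for k
  proof -
    define \<xi> where "\<xi> = (\<theta> - \<eta>) ^ k"
    have \<xi>: "absv \<xi> = (1 / real q) ^ k" unfolding \<xi>_def by (rule absv_pi_power)
    have \<xi>1: "absv \<xi> \<le> 1" unfolding \<xi> using q_ge_2 by (intro power_le_one) auto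
    have \<xi>0: "absv \<xi> > 0" unfolding \<xi> using q_ge_2 by simp
    have "(\<lambda>m. fps_nth H m * \<xi> ^ m + (if m = n then - (fps_nth H n * \<xi> ^ n) else 0))
        sums (0 + - (fps_nth H n * \<xi> ^ n))"
      using sums_single[of n "\<lambda>_. - (fps_nth H n * \<xi> ^ n)"] by (intro sums_absv_add assms)
    then have "absv (0 + - (fps_nth H n * \<xi> ^ n)) \<le> B * absv \<xi> ^ Suc n"
    proof (rule sums_absv_le)
      fix m
      have B0: "B \<ge> 0" using HB[of 0] absv_nonneg order.trans by blast
      consider "m < n" | "m = n" | "m > n" by linarith
      then show "absv (fps_nth H m * \<xi> ^ m + (if m = n then - (fps_nth H n * \<xi> ^ n) else 0))
          \<le> B * absv \<xi> ^ Suc n"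
      proof cases
        case 3
        then have "absv \<xi> ^ m \<le> absv \<xi> ^ Suc n" using \<xi>1 by (intro power_decreasing) auto
        then have "absv (fps_nth H m) * absv \<xi> ^ m \<le> B * absv \<xi> ^ Suc n"
          using HB B0 by (intro mult_mono) auto
        then show ?thesis using 3 by (simp add: absv_mult absv_power)
      qed (use B0 lt in simp_all)
    qed
    then have "absv (fps_nth H n) * absv \<xi> ^ n \<le> (B * absv \<xi>) * absv \<xi> ^ n"
      by (simp add: absv_mult absv_power)
    then show ?thesis using \<xi>0 \<xi> by (simp add: mult_le_cancel_right)
  qed
  have "(\<lambda>k. B * (1 / real q) ^ k) \<longlonglongrightarrow> B * 0"
    using q_ge_2 by (intro tendsto_mult_left LIMSEQ_realpow_zero) auto
  then have "absv (fps_nth H n) \<le> B * 0" by (rule LIMSEQ_le_const) (use small in blast)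
  then have "absv (fps_nth H n) \<le> 0" by simp
  moreover have "absv (fps_nth H n) > 0" using Hn by (simp only: absv_pos_iff) simp
  ultimately show False by linarith
qed

lemma exp0_series_eq: "exp0_series emb \<rho> \<theta> \<eta> = additive_fps (\<lambda>i. 1 / D i)"
  unfolding exp0_series_def exp0_eq
proof (rule the_equality)
  let ?F = "additive_fps (\<lambda>i. 1 / D i)"
  show F: "\<forall>\<xi>. (\<lambda>n. fps_nth ?F n * \<xi> ^ n) sums expo \<xi>"
    unfolding additive_fps_sums using expo_sums by simp
  fix G assume G: "\<forall>\<xi>. (\<lambda>n. fps_nth G n * \<xi> ^ n) sums expo \<xi>"
  have "G - ?F = 0"
  proof (rule fps_eq_0_of_sums_0)
    fix \<xi>
    have "(\<lambda>n. fps_nth G n * \<xi> ^ n + (- 1) * (fps_nth ?F n * \<xi> ^ n)) sums (expo \<xi> + (- 1) * expo \<xi>)"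
      using F G by (intro sums_absv_add sums_absv_scale) auto
    then show "(\<lambda>n. fps_nth (G - ?F) n * \<xi> ^ n) sums 0" by (simp add: left_diff_distrib)
  qed
  then show "G = ?F" by simp
qed

section \<open>The logarithm\<close>

abbreviation L :: "nat \<Rightarrow> 'c" where "L \<equiv> L_coeff q N \<theta> \<eta>"

definition log_coeff :: "nat \<Rightarrow> 'c" where "log_coeff j = (- 1) ^ j / L j"

lemma frob_conj_nat: "frob_conj q N \<eta> (int i) = eta i"
  unfolding frob_conj_def by (simp only: zmod_int[symmetric] nat_int eta_mod)

lemma frob_conj_minus_1: "frob_conj q N \<eta> (- 1) = eta (N - 1)"
proof -
  have "(- 1) mod int N = int (N - 1)" using N_ge_2 by (simp add: zmod_minus1 of_nat_diff)
  then show ?thesis by (simp add: frob_conj_def)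
qed

lemma frob_conj_eq_eta: "\<exists>i. frob_conj q N \<eta> n = eta i"
  unfolding frob_conj_def by blast

lemma theta_neq_frob_conj [simp]: "\<theta> \<noteq> frob_conj q N \<eta> n"
  using frob_conj_eq_eta[of n] th_neq_eta[of 0] by auto

lemma L_nonzero [simp]: "L j \<noteq> 0"
proof (induction j)
  case (Suc j)
  then show ?case using theta_neq_th[of "Suc j"] by (simp del: power_Suc)
qed simp

text \<open>Each step has a numerator of size at least \<open>1 / q\<close> and a denominator of
  size at most 1. This crude estimate suffices, since \<open>q ^ j\<close> is harmless against
  \<open>\<xi> ^ (q ^ j)\<close> for small \<open>\<xi>\<close>.\<close>

lemma absv_L_ge: "absv (L j) \<ge> (1 / real q) ^ j"
proof (induction j)
  case (Suc j)
  have le1: "absv (\<theta> - eta i) \<le> 1" for i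
    using absv_th_minus_eta[of 0 i] q_ge_2 by simp
  then have le: "absv (\<theta> - frob_conj q N \<eta> n) \<le> 1" for n
    using frob_conj_eq_eta[of n] by auto
  have le0: "absv (\<theta> - \<eta>) \<le> 1" using le1[of 0] by simp
  let ?num = "\<theta> - th (Suc j)"
  let ?den = "(\<theta> - frob_conj q N \<eta> (int (Suc j) - 2)) * (\<theta> - \<eta>) ^ (q ^ j) *
       (\<theta> - frob_conj q N \<eta> (- 1)) ^ (q ^ Suc j - q ^ j)"
  have "absv ?den \<le> 1" unfolding absv_mult absv_power
    by (intro mult_le_one power_le_one mult_nonneg_nonneg zero_le_power absv_nonneg le le0)
  moreover have "absv ?den > 0" by (simp del: power_Suc)
  moreover have "1 / real q \<le> absv ?num"
    using absv_theta_minus_th[of "Suc j"] q_ge_2 by (simp del: power_Suc)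
  ultimately have "1 / real q \<le> absv ?num / absv ?den"
    using frac_le[of "absv ?num" "1 / real q" "absv ?den" 1] by simp
  then have "(1 / real q) ^ j * (1 / real q) \<le> absv (L j) * (absv ?num / absv ?den)"
    using Suc by (intro mult_mono) auto
  then show ?case by (simp only: L_coeff.simps absv_mult absv_divide power_Suc2)
qed simp

lemma absv_log_coeff_le: "absv (log_coeff j) \<le> real q ^ j"
proof -
  have "absv (log_coeff j) = 1 / absv (L j)"
    by (simp add: log_coeff_def absv_divide absv_power)
  also have "\<dots> \<le> 1 / (1 / real q) ^ j"
    using absv_L_ge[of j] q_ge_2 by (intro divide_left_mono mult_pos_pos) auto
  finally show ?thesis by (simp add: power_one_over)
qed

text \<open>The partial sums of \<open>\<Sum>\<^sub>i l\<^sub>i s\<^sub>i\<close> with \<open>l\<^sub>i = (-1)\<^sup>i / L\<^sub>i\<close> are the products \<open>log_prod n\<close>, which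
  vanish at \<open>\<theta>\<^sup>q, \<dots>, \<theta>\<^bsup>q^n\<^esup>\<close>.\<close>

definition log_prod :: "nat \<Rightarrow> 'c \<Rightarrow> 'c" where
  "log_prod n x = (\<Prod>k<n. ((x - th (Suc k)) * (\<theta> - eta k)) / ((\<theta> - th (Suc k)) * (x - eta k)))"

text \<open>Here \<open>eta (N - 1)\<close> is the conjugate of \<open>\<eta>\<close> under inverse
  Frobenius, and its \<open>q ^ Suc m\<close> power is \<open>eta m\<close> by periodicity. This
  explains the factor \<open>\<theta> - frob_conj q N \<eta> (- 1)\<close> in
  \<open>L_coeff\<close>.\<close>

lemma th_Suc_minus_eta: "th (Suc m) - eta m = (\<theta> - eta (N - 1)) ^ (q ^ Suc m)"
proof -
  have "eta (N - 1) ^ (q ^ Suc m) = eta (N - 1 + Suc m)" by (simp only: eta_add)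
  also have "N - 1 + Suc m = m + 1 * N" using N_ge_2 by simp
  finally show ?thesis by (simp only: frob_diff eta_mult_N)
qed

text \<open>The right-hand side is the increment \<open>log_prod (Suc n) x - log_prod n x\<close>.
  The induction compares ratios of consecutive terms on both sides.\<close>

lemma log_coeff_s_val:
  assumes x: "\<And>k. x \<noteq> eta k"
  shows "log_coeff (Suc n) * s_val (Suc n) x =
    log_prod n x * (((x - \<theta>) * (th (Suc n) - eta n)) / ((\<theta> - th (Suc n)) * (x - eta n)))"
proof (induction n)
  case 0
  let ?e = "\<theta> - eta (N - 1)"
  have e: "?e \<noteq> 0" using th_neq_eta[of 0] by simp
  \<comment> \<open>For the first coefficient \<open>1 - 2 = - 1\<close>, so two factors of the
    denominator of \<open>L_coeff\<close> coincide up to exponents and combine to the full power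
    \<open>?e ^ q\<close>, which is \<open>\<theta> ^ q - \<eta>\<close>.\<close>
  have q1: "?e ^ q = ?e * ?e ^ (q - 1)" using q_ge_2 by (simp flip: power_Suc)
  have t: "\<theta> - \<theta> ^ q \<noteq> 0" using theta_neq_th[of 1] by simp
  have x0: "x - \<eta> \<noteq> 0" using x[of 0] by simp
  have th1: "\<theta> ^ q - \<eta> = ?e ^ q" using th_Suc_minus_eta[of 0] by simp
  have "log_coeff (Suc 0) = - (?e ^ q * (\<theta> - \<eta>) / (\<theta> - \<theta> ^ q))"
    using q1 by (simp add: log_coeff_def frob_conj_minus_1 mult_ac)
  moreover have "s_val (Suc 0) x = - ((x - \<theta>) / ((\<theta> - \<eta>) * (x - \<eta>)))"
    by (simp add: s_val_def minus_divide_left del: minus_divide_left[symmetric])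
  ultimately have "log_coeff (Suc 0) * s_val (Suc 0) x
     = (?e ^ q * (\<theta> - \<eta>) / (\<theta> - \<theta> ^ q)) * ((x - \<theta>) / ((\<theta> - \<eta>) * (x - \<eta>)))" by simp
  also have "\<dots> = ((x - \<theta>) * ?e ^ q) / ((\<theta> - \<theta> ^ q) * (x - \<eta>))"
    using t x0 by (simp add: divide_simps)
  finally show ?case by (simp add: log_prod_def th1)
next
  case (Suc n)
  define e where "e = \<theta> - eta (N - 1)"
  have e: "e \<noteq> 0" using th_neq_eta[of 0] by (simp add: e_def)
  define E1 where "E1 = th (Suc n) - eta n"
  define E2 where "E2 = th (Suc (Suc n)) - eta (Suc n)"
  define p where "p = (\<theta> - \<eta>) ^ (q ^ Suc n)"
  define t1 where "t1 = \<theta> - th (Suc n)"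
  define t2 where "t2 = \<theta> - th (Suc (Suc n))"
  define a where "a = \<theta> - eta n"
  define b where "b = x - eta n"
  define c where "c = x - eta (Suc n)"
  define y where "y = x - th (Suc n)"
  define R where "R = log_prod n x"
  define z where "z = x - \<theta>"
  have nz: "E1 \<noteq> 0" "p \<noteq> 0" "t1 \<noteq> 0" "t2 \<noteq> 0" "a \<noteq> 0" "b \<noteq> 0" "c \<noteq> 0"
    using x[of n] x[of "Suc n"] th_neq_eta[of "Suc n" n] th_neq_eta[of 0 n]
      theta_neq_th[of "Suc n"] theta_neq_th[of "Suc (Suc n)"]
    by (simp_all add: E1_def p_def t1_def t2_def a_def b_def c_def del: power_Suc)
  \<comment> \<open>\<open>E1\<close> and \<open>E2\<close> are Frobenius powers of
    \<open>e\<close>, so the difference of exponents in \<open>L_coeff\<close> becomes their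
    quotient.\<close>
  have E: "e ^ (q ^ Suc (Suc n) - q ^ Suc n) = E2 / E1"
  proof -
    have "q ^ Suc n \<le> q ^ Suc (Suc n)" using q_ge_2 by (intro power_increasing) auto
    then have "e ^ (q ^ Suc (Suc n) - q ^ Suc n) = e ^ (q ^ Suc (Suc n)) / e ^ (q ^ Suc n)"
      by (rule power_diff[OF e])
    then show ?thesis by (simp only: E1_def E2_def th_Suc_minus_eta e_def)
  qed
  have i2: "int (Suc (Suc n)) - 2 = int n" by simp
  have "log_coeff (Suc (Suc n)) = - log_coeff (Suc n) * ((a * p * (E2 / E1)) / t2)"
    unfolding log_coeff_def L_coeff.simps(2)[of _ _ _ _ "Suc n"] i2 frob_conj_nat frob_conj_minus_1
      e_def[symmetric] E a_def[symmetric] p_def[symmetric] t2_def[symmetric]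
    by (simp del: L_coeff.simps)
  moreover have "s_val (Suc (Suc n)) x = - s_val (Suc n) x * (y / (p * c))"
    unfolding s_val_def prod.lessThan_Suc[of _ "Suc n"] p_def[symmetric] c_def[symmetric]
    by (simp add: y_def minus_divide_left del: power_Suc prod.lessThan_Suc minus_divide_left[symmetric])
       (simp add: right_diff_distrib diff_divide_distrib del: power_Suc prod.lessThan_Suc)
  ultimately have "log_coeff (Suc (Suc n)) * s_val (Suc (Suc n)) x =
      (log_coeff (Suc n) * s_val (Suc n) x) * (((a * p * (E2 / E1)) / t2) * (y / (p * c)))"
    by simp
  also have "log_coeff (Suc n) * s_val (Suc n) x = R * ((z * E1) / (t1 * b))"
    using Suc by (simp only: R_def z_def E1_def t1_def b_def)
  also have "R * ((z * E1) / (t1 * b)) * (((a * p * (E2 / E1)) / t2) * (y / (p * c)))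
      = (R * ((y * a) / (t1 * b))) * ((z * E2) / (t2 * c))"
    using nz by (simp add: divide_simps)
  also have "R * ((y * a) / (t1 * b)) = log_prod (Suc n) x"
    by (simp only: R_def log_prod_def prod.lessThan_Suc y_def a_def t1_def b_def)
  finally show ?case by (simp only: z_def E2_def t2_def c_def)
qed

text \<open>A telescoping sum: one plus the relative increment from \<open>log_coeff_s_val\<close>
  factors into the next factor of \<open>log_prod\<close>.\<close>

lemma sum_log_coeff_s_val:
  assumes x: "\<And>k. x \<noteq> eta k"
  shows "(\<Sum>i\<le>n. log_coeff i * s_val i x) = log_prod n x"
proof (induction n)
  case (Suc n)
  define t where "t = th (Suc n)"
  define y where "y = eta n"
  have nz: "\<theta> - t \<noteq> 0" "x - y \<noteq> 0" using theta_neq_th[of "Suc n"] x[of n] by (simp_all add: t_def y_def del: power_Suc)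
  have "(\<Sum>i\<le>Suc n. log_coeff i * s_val i x) =
      log_prod n x * (1 + ((x - \<theta>) * (t - y)) / ((\<theta> - t) * (x - y)))"
    by (simp only: sum.atMost_Suc Suc log_coeff_s_val[OF x] t_def y_def distrib_left mult.right_neutral)
  also have "1 + ((x - \<theta>) * (t - y)) / ((\<theta> - t) * (x - y)) =
      ((x - t) * (\<theta> - y)) / ((\<theta> - t) * (x - y))"
  proof -
    have "(\<theta> - t) * (x - y) + (x - \<theta>) * (t - y) = (x - t) * (\<theta> - y)" by (simp add: algebra_simps)
    then show ?thesis using nz by (simp add: add_divide_distrib[symmetric] divide_add_eq_iff add_divide_eq_iff)
  qed
  finally show ?case by (simp only: log_prod_def prod.lessThan_Suc t_def y_def)
qed (simp add: log_coeff_def s_val_def log_prod_def)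

lemma log_exp_coeff:
  "(\<Sum>i\<le>n. log_coeff i * (1 / D (n - i)) ^ (q ^ i)) = (if n = 0 then 1 else 0)"
proof -
  have "(\<Sum>i\<le>n. log_coeff i * (1 / D (n - i)) ^ (q ^ i)) * D n =
      (\<Sum>i\<le>n. log_coeff i * s_val i (th n))"
    unfolding sum_distrib_right by (intro sum.cong refl) (simp add: s_val_th power_one_over)
  also have "\<dots> = log_prod n (th n)" by (rule sum_log_coeff_s_val) simp
  also have "\<dots> = (if n = 0 then 1 else 0)"
    \<comment> \<open>For \<open>n > 0\<close> the last factor of the product contains
      \<open>x - th n\<close>.\<close>
    by (cases n) (simp_all add: log_prod_def del: power_Suc)
  finally show ?thesis by (cases "n = 0") simp_all
qed

lemma log_oo_exp: "additive_fps log_coeff oo additive_fps (\<lambda>i. 1 / D i) = fps_X"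
  unfolding additive_fps_compose log_exp_coeff additive_fps_X ..

text \<open>By associativity of composition, the left inverse from \<open>log_oo_exp\<close> agrees
  with the right inverse \<open>fps_inv\<close>.\<close>

lemma log0_series_eq: "log0_series emb \<rho> \<theta> \<eta> = additive_fps log_coeff"
proof -
  let ?F = "additive_fps (\<lambda>i. 1 / D i)" and ?G = "additive_fps log_coeff"
  have "0 \<notin> range (\<lambda>i. q ^ i)" by auto
  then have F0: "fps_nth ?F 0 = 0" by (rule additive_fps_nth_eq_0)
  have F1: "fps_nth ?F 1 \<noteq> 0" using additive_fps_nth_q_power[of "\<lambda>i. 1 / D i" 0] by simp
  have i0: "fps_nth (fps_inv ?F) 0 = 0" by (simp add: fps_inv_def)
  have "?G = ?G oo (?F oo fps_inv ?F)" by (simp add: fps_inv_right[OF F0 F1])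
  also have "\<dots> = fps_X oo fps_inv ?F" by (simp only: fps_compose_assoc[OF i0 F0] log_oo_exp)
  also have "\<dots> = fps_inv ?F" by (rule fps_X_fps_compose_startby0[OF i0])
  finally show ?thesis by (simp add: log0_series_def exp0_series_eq)
qed

text \<open>The inverse is two-sided, so the relation also holds in the other order, the one
  required for applying the exponential to partial sums of the logarithm.\<close>

lemma exp_log_coeff:
  "(\<Sum>i\<le>n. 1 / D i * log_coeff (n - i) ^ (q ^ i)) = (if n = 0 then 1 else 0)"
proof -
  let ?F = "additive_fps (\<lambda>i. 1 / D i)"
  have "0 \<notin> range (\<lambda>i. q ^ i)" by auto
  then have F0: "fps_nth ?F 0 = 0" by (rule additive_fps_nth_eq_0)
  have F1: "fps_nth ?F 1 \<noteq> 0" using additive_fps_nth_q_power[of "\<lambda>i. 1 / D i" 0] by simp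
  have "?F oo additive_fps log_coeff = fps_X"
    using fps_inv_right[OF F0 F1] log0_series_eq by (simp add: log0_series_def exp0_series_eq)
  then have "fps_nth (?F oo additive_fps log_coeff) (q ^ n) = fps_nth fps_X (q ^ n)" by simp
  then show ?thesis
    unfolding additive_fps_compose additive_fps_nth_q_power using q_power_eq_iff[of n 0] by simp
qed

section \<open>Convergence of the logarithm near 0 and its inversion by the exponential\<close>

lemma log_term_le:
  assumes "absv \<xi> < (1 / real q) ^ 2"
  shows "absv (log_coeff j * \<xi> ^ (q ^ j)) \<le> (1 / real q) ^ (q ^ j)"
proof -
  \<comment> \<open>One of the two factors \<open>1 / q\<close> in the radius absorbs
    \<open>q ^ j \<le> q ^ (q ^ j)\<close>; the other leaves the decay.\<close>
  have "real q ^ j \<le> real q ^ (q ^ j)" using q_ge_2 le_q_power by (intro power_increasing) auto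
  then have "absv (log_coeff j) \<le> real q ^ (q ^ j)" using absv_log_coeff_le[of j] by linarith
  moreover have "absv \<xi> ^ (q ^ j) \<le> ((1 / real q) ^ 2) ^ (q ^ j)"
    using assms by (intro power_mono) auto
  ultimately have "absv (log_coeff j) * absv \<xi> ^ (q ^ j)
      \<le> real q ^ (q ^ j) * ((1 / real q) ^ 2) ^ (q ^ j)"
    by (intro mult_mono) auto
  also have "\<dots> = (real q * (1 / real q) ^ 2) ^ (q ^ j)" by (simp only: power_mult_distrib)
  also have "real q * (1 / real q) ^ 2 = 1 / real q" using q_ge_2 by (simp add: power2_eq_square)
  finally show ?thesis by (simp add: absv_mult absv_power)
qed

lemma log0_sums:
  assumes "absv \<xi> < (1 / real q) ^ 2"
  shows "(\<lambda>j. log_coeff j * \<xi> ^ (q ^ j)) sums log0 emb \<rho> \<theta> \<eta> \<xi>"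
proof -
  have "summable (\<lambda>j. log_coeff j * \<xi> ^ (q ^ j))"
  proof (rule summable_absv, rule Lim_null_comparison)
    show "\<forall>\<^sub>F j in sequentially. norm (absv (log_coeff j * \<xi> ^ (q ^ j))) \<le> (1 / real q) ^ j"
    proof (rule always_eventually, rule allI)
      fix j
      have "(1 / real q) ^ (q ^ j) \<le> (1 / real q) ^ j"
        using q_ge_2 le_q_power by (intro power_decreasing) auto
      then show "norm (absv (log_coeff j * \<xi> ^ (q ^ j))) \<le> (1 / real q) ^ j"
        using log_term_le[OF assms, of j] by simp
    qed
    show "(\<lambda>j. (1 / real q) ^ j) \<longlonglongrightarrow> 0"
      using q_ge_2 by (intro LIMSEQ_realpow_zero) auto
  qed
  then obtain s where s: "(\<lambda>j. log_coeff j * \<xi> ^ (q ^ j)) sums s" by (auto simp: summable_def)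
  then have "(\<lambda>n. fps_nth (additive_fps log_coeff) n * \<xi> ^ n) sums s" by (simp add: additive_fps_sums)
  then have "log0 emb \<rho> \<theta> \<eta> \<xi> = s" unfolding log0_def log0_series_eq by (rule sums_unique[symmetric])
  then show ?thesis using s by simp
qed

lemma absv_expo_le: "absv h \<le> 1 \<Longrightarrow> absv (expo h) \<le> absv h"
proof -
  assume h: "absv h \<le> 1"
  have "absv h ^ 2 \<le> absv h ^ 1" using h by (intro power_decreasing) auto
  then have "absv (expo h - h) \<le> absv h" using absv_expo_minus_self[OF h] by simp
  then show ?thesis using absv_add[of "expo h - h" h] by simp
qed

lemma expo_sum: "expo (\<Sum>j\<in>A. g j) = (\<Sum>j\<in>A. expo (g j))"
  by (induction A rule: infinite_finite_induct) (simp_all add: expo_add)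

text \<open>The double series is grouped by powers \<open>\<xi> ^ (q ^ m)\<close>, with
  \<open>u j m\<close> the share of the summand \<open>j\<close>. For \<open>m < n\<close> the group
  is complete, and \<open>exp_log_coeff\<close> leaves only \<open>\<xi>\<close>; for
  \<open>m \<ge> n\<close> it is incomplete, but each share is at most
  \<open>(1 / q) ^ (q ^ m)\<close>.\<close>

lemma expo_partial_log:
  assumes \<xi>: "absv \<xi> < (1 / real q) ^ 2" and n: "n > 0"
  shows "absv (expo (\<Sum>j<n. log_coeff j * \<xi> ^ (q ^ j)) - \<xi>) \<le> (1 / real q) ^ n"
proof -
  define y where "y j = log_coeff j * \<xi> ^ (q ^ j)" for j
  define u where "u j m = (if j \<le> m then y j ^ (q ^ (m - j)) / D (m - j) else 0)" for j m
  have u_le: "absv (u j m) \<le> (1 / real q) ^ (q ^ m)" for j m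
  proof (cases "j \<le> m")
    case True
    have "absv (y j) ^ (q ^ (m - j)) \<le> ((1 / real q) ^ (q ^ j)) ^ (q ^ (m - j))"
      using log_term_le[OF \<xi>, of j] by (intro power_mono) (auto simp: y_def)
    also have "\<dots> = (1 / real q) ^ (q ^ m)"
      using True by (simp only: power_mult[symmetric] power_add[symmetric] le_add_diff_inverse)
    finally have *: "absv (y j) ^ (q ^ (m - j)) \<le> (1 / real q) ^ (q ^ m)" .
    have "absv (y j) ^ (q ^ (m - j)) / absv (D (m - j)) \<le> absv (y j) ^ (q ^ (m - j)) / 1"
      using absv_D_ge_1[of "m - j"] by (intro divide_left_mono) auto
    then show ?thesis using True * by (simp add: u_def absv_divide absv_power)
  qed (simp add: u_def)
  have "u j sums expo (y j)" for j
    using sums_absv_shift[OF expo_sums[of "y j"], of j] by (simp add: u_def[abs_def])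
  then have "(\<lambda>m. \<Sum>j<n. u j m) sums (\<Sum>j<n. expo (y j))"
    by (intro sums_absv_sum) auto
  then have "(\<lambda>m. (\<Sum>j<n. u j m) + (if m = 0 then - \<xi> else 0)) sums ((\<Sum>j<n. expo (y j)) + - \<xi>)"
    by (intro sums_absv_add sums_single)
  then have "absv ((\<Sum>j<n. expo (y j)) + - \<xi>) \<le> (1 / real q) ^ n"
  proof (rule sums_absv_le)
    fix m
    show "absv ((\<Sum>j<n. u j m) + (if m = 0 then - \<xi> else 0)) \<le> (1 / real q) ^ n"
    proof (cases "m < n")
      case True
      have "(\<Sum>j<n. u j m) = (\<Sum>j\<le>m. u j m)"
        using True by (intro sum.mono_neutral_right) (auto simp: u_def)
      also have "\<dots> = (\<Sum>i\<le>m. u (m - i) m)"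
        by (rule sum.reindex_bij_witness[of _ "\<lambda>i. m - i" "\<lambda>i. m - i"]) auto
      also have "\<dots> = (\<Sum>i\<le>m. (1 / D i * log_coeff (m - i) ^ (q ^ i)) * \<xi> ^ (q ^ m))"
      proof (intro sum.cong refl)
        fix i assume i: "i \<in> {..m}"
        then have "(\<xi> ^ (q ^ (m - i))) ^ (q ^ i) = \<xi> ^ (q ^ m)"
          by (simp flip: power_mult power_add)
        then show "u (m - i) m = (1 / D i * log_coeff (m - i) ^ (q ^ i)) * \<xi> ^ (q ^ m)"
          using i by (simp add: u_def y_def power_mult_distrib)
      qed
      also have "\<dots> = (if m = 0 then 1 else 0) * \<xi> ^ (q ^ m)"
        by (simp only: sum_distrib_right[symmetric] exp_log_coeff)
      finally show ?thesis by simp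
    next
      case False
      then have "n \<le> q ^ m" using le_q_power[of m] by linarith
      then have "(1 / real q) ^ (q ^ m) \<le> (1 / real q) ^ n"
        using q_ge_2 by (intro power_decreasing) auto
      moreover have "absv (\<Sum>j<n. u j m) \<le> (1 / real q) ^ (q ^ m)"
        by (intro absv_sum_le u_le) simp
      ultimately show ?thesis using False n by simp
    qed
  qed
  then show ?thesis by (simp add: expo_sum y_def)
qed

text \<open>Additivity and \<open>absv_expo_le\<close> make \<open>expo\<close> continuous, so it
  may be applied to the limit of the partial sums, whose images tend to
  \<open>\<xi>\<close>.\<close>

lemma expo_log0:
  assumes \<xi>: "absv \<xi> < (1 / real q) ^ 2"
  shows "expo (log0 emb \<rho> \<theta> \<eta> \<xi>) = \<xi>"
proof -
  let ?T = "\<lambda>n. \<Sum>j<n. log_coeff j * \<xi> ^ (q ^ j)" and ?s = "log0 emb \<rho> \<theta> \<eta> \<xi>"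
  have T: "?T \<longlonglongrightarrow> ?s" using log0_sums[OF \<xi>] by (simp add: sums_def)
  have "(\<lambda>n. expo (?T n)) \<longlonglongrightarrow> expo ?s"
  proof (rule tendsto_absv_bound)
    show "(\<lambda>n. absv (?T n - ?s)) \<longlonglongrightarrow> 0" using T unfolding tendsto_absv_iff .
    then have "\<forall>\<^sub>F n in sequentially. absv (?T n - ?s) < 1" by (rule order_tendstoD) simp
    then show "\<forall>\<^sub>F n in sequentially. absv (expo (?T n) - expo ?s) \<le> absv (?T n - ?s)"
    proof eventually_elim
      case (elim n)
      have "expo (?T n) = expo (?T n - ?s) + expo ?s" by (simp flip: expo_add)
      then show ?case using absv_expo_le[of "?T n - ?s"] elim by simp
    qed
  qed
  moreover have "(\<lambda>n. expo (?T n)) \<longlonglongrightarrow> \<xi>"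
  proof (rule tendsto_absv_bound)
    show "\<forall>\<^sub>F n in sequentially. absv (expo (?T n) - \<xi>) \<le> (1 / real q) ^ n"
      using eventually_gt_at_top[of 0] by eventually_elim (rule expo_partial_log[OF \<xi>])
    show "(\<lambda>n. (1 / real q) ^ n) \<longlonglongrightarrow> 0" using q_ge_2 by (intro LIMSEQ_realpow_zero) auto
  qed
  ultimately show ?thesis by (rule LIMSEQ_unique)
qed

end

theorem theorem1:
  fixes absv :: "'c::{field,complete_space} \<Rightarrow> real"
    and emb :: "'f::{field,finite} \<Rightarrow> 'c"
    and \<rho> :: "'f poly"
    and \<theta> \<eta> :: 'c
  assumes "lead_coeff \<rho> = 1"
    and "irreducible \<rho>"
    and "degree \<rho> \<ge> 2"
    and "rho_adic_C_infinity absv emb \<rho> \<theta>"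
    and "poly (map_poly emb \<rho>) \<eta> = 0"
    and "absv (\<theta> - \<eta>) = 1 / real CARD('f)"
  shows
    "((\<exists>!e. is_exponential emb \<rho> \<theta> \<eta> e) \<and>
      Fq_linear emb (exp0 emb \<rho> \<theta> \<eta>) \<and>
      (\<forall>\<xi>. (\<lambda>i. \<xi> ^ (CARD('f) ^ i) / D_coeff CARD('f) \<theta> \<eta> i) sums exp0 emb \<rho> \<theta> \<eta> \<xi>)) \<and>
     ((\<forall>j. fps_nth (log0_series emb \<rho> \<theta> \<eta>) (CARD('f) ^ j) =
           (- 1) ^ j / L_coeff CARD('f) (degree \<rho>) \<theta> \<eta> j) \<and>
      (\<forall>n. n \<notin> range (\<lambda>j. CARD('f) ^ j) \<longrightarrow>
           fps_nth (log0_series emb \<rho> \<theta> \<eta>) n = 0) \<and>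
      (\<exists>r>0. \<forall>\<xi>. absv \<xi> < r \<longrightarrow>
         (\<lambda>j. (- 1) ^ j * \<xi> ^ (CARD('f) ^ j) / L_coeff CARD('f) (degree \<rho>) \<theta> \<eta> j)
           sums log0 emb \<rho> \<theta> \<eta> \<xi> \<and>
         exp0 emb \<rho> \<theta> \<eta> (log0 emb \<rho> \<theta> \<eta> \<xi>) = \<xi>))"
proof -
  interpret rho_adic_root absv emb \<rho> \<theta> \<eta> "CARD('f)" "degree \<rho>"
    using assms by (intro rho_adic_root.intro rho_adic_root_axioms.intro) auto
  have series: "log_coeff j * \<xi> ^ (CARD('f) ^ j) =
      (- 1) ^ j * \<xi> ^ (CARD('f) ^ j) / L j" for j \<xi>
    by (simp add: log_coeff_def)
  have "\<exists>!e. is_exponential emb \<rho> \<theta> \<eta> e"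
    using is_exponential_expo exponential_unique by blast
  moreover have "\<exists>r>0. \<forall>\<xi>. absv \<xi> < r \<longrightarrow>
      (\<lambda>j. (- 1) ^ j * \<xi> ^ (CARD('f) ^ j) / L j) sums log0 emb \<rho> \<theta> \<eta> \<xi> \<and>
      expo (log0 emb \<rho> \<theta> \<eta> \<xi>) = \<xi>"
    using log0_sums expo_log0 unfolding series
    by (intro exI[of _ "(1 / real CARD('f)) ^ 2"]) simp
  ultimately show ?thesis
    unfolding exp0_eq log0_series_eq
    using Fq_linear_expo expo_sums additive_fps_nth_eq_0 by (simp add: log_coeff_def)
qed

end
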